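(* Let $m\ge1$ be an integer and let $\underline{c}=(c_1,c_2,c_3,\ldots)$, $\underline{d}=(d_1,d_2,d_3,\ldots)\in\Sigma_{m+1}$ with $\underline{c}<\underline{d}$. Then $\dim_H(M_{\underline{c},\underline{d}})=\dim_H(M_{\underline{c},\underline{d}}')$.
   Context: $\Sigma_{m+1}=\{0,1,\ldots,m\}^{\mathbb{N}}$ (sequences $\underline{x}=(x_1,x_2,\ldots)$) is equipped with the shift $(\sigma(\underline{x}))_i=x_{i+1}$, the lexicographic order $<$, and the metric $d(\underline{a},\underline{b})=\sum_{i\ge1}|a_i-b_i|/(m+1)^i$, with respect to which Hausdorff dimension $\dim_H$ is taken. For $\underline{c},\underline{d}\in\Sigma_{m+1}$, $$M_{\underline{c},\underline{d}}'=\{\underline{x}\in\Sigma_{m+1}:\ \underline{c}\le\sigma^n(\underline{x})\le\underline{d},\ \forall n\ge0\},$$ $$M_{\underline{c},\underline{d}}=\{\underline{x}\in\Sigma_{m+1}:\ \underline{c}\le\sigma^n(\underline{x})<\underline{x}\le\underline{d},\ \forall n\ge1\}.$$ *)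

theory Defs
  imports "HOL-Analysis.Analysis" "HOL-Library.Fun_Lexorder"
begin

section \<open>Hausdorff dimension\<close>

context Metric_space
begin

definition ediam :: "'a set \<Rightarrow> ennreal"
  where "ediam U = (SUP x\<in>U. SUP y\<in>U. ennreal (d x y))"

text \<open>
  The contribution \<open>(diam U)\<^sup>s\<close> of a set to a cover. It is used only for sets of finite diameter.
  The conventions are \<open>0\<^sup>0 = 1\<close> for nonempty \<open>U\<close> (whereas \<open>0 powr 0 = 0\<close> in HOL) and
  \<open>(diam {})\<^sup>s = 0\<close>, so that the measure for \<open>s = 0\<close> is the counting measure.
\<close>
definition hausdorff_gauge :: "real \<Rightarrow> 'a set \<Rightarrow> ennreal"
  where "hausdorff_gauge s U =
    (if U = {} then 0 else if s = 0 then 1 else ennreal (enn2real (ediam U) powr s))"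

definition hausdorff_premeasure :: "real \<Rightarrow> real \<Rightarrow> 'a set \<Rightarrow> ennreal"
  where "hausdorff_premeasure s \<delta> A =
    (INF U\<in>{U :: nat \<Rightarrow> 'a set.
        (\<forall>i. U i \<subseteq> M \<and> ediam (U i) \<le> ennreal \<delta>) \<and> A \<subseteq> (\<Union>i. U i)}.
      \<Sum>i. hausdorff_gauge s (U i))"

definition hausdorff_measure :: "real \<Rightarrow> 'a set \<Rightarrow> ennreal"
  where "hausdorff_measure s A = (SUP \<delta>\<in>{0<..}. hausdorff_premeasure s \<delta> A)"

text \<open>By this definition the empty set has dimension \<open>0\<close>.\<close>
definition hausdorff_dim :: "'a set \<Rightarrow> ennreal"
  where "hausdorff_dim A = (INF s\<in>{s. 0 \<le> s \<and> hausdorff_measure s A = 0}. ennreal s)"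

end


section \<open>Sequences over the digits \<open>0, \<dots>, m\<close>\<close>

text \<open>
  Sequences are indexed from \<open>0\<close>: the paper's \<open>x\<^sub>i\<close> with \<open>i \<ge> 1\<close> is \<open>x (i - 1)\<close> here,
  hence the exponent \<open>Suc i\<close> in the metric.
\<close>

definition digit_seqs :: "nat \<Rightarrow> (nat \<Rightarrow> nat) set"
  where "digit_seqs m = UNIV \<rightarrow> {0..m}"

definition shift :: "(nat \<Rightarrow> nat) \<Rightarrow> nat \<Rightarrow> nat"
  where "shift x = (\<lambda>i. x (Suc i))"

text \<open>
  The terms are nonnegative, so \<open>infsum\<close> agrees with the usual sum of the series on
  \<^term>\<open>digit_seqs m\<close>. Unlike \<open>suminf\<close> it is \<open>0\<close> where the series diverges, and the locale
  \<open>Metric_space\<close> requires nonnegativity even off the carrier.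
\<close>
definition seq_dist :: "nat \<Rightarrow> (nat \<Rightarrow> nat) \<Rightarrow> (nat \<Rightarrow> nat) \<Rightarrow> real"
  where "seq_dist m a b =
    (\<Sum>\<^sub>\<infinity>i\<in>UNIV. \<bar>real (a i) - real (b i)\<bar> / real (m + 1) ^ Suc i)"

text \<open>\<^const>\<open>less_fun\<close> is the strict lexicographic order.\<close>
definition lex_le :: "(nat \<Rightarrow> nat) \<Rightarrow> (nat \<Rightarrow> nat) \<Rightarrow> bool"
  where "lex_le x y \<longleftrightarrow> less_fun x y \<or> x = y"

definition M'_set :: "nat \<Rightarrow> (nat \<Rightarrow> nat) \<Rightarrow> (nat \<Rightarrow> nat) \<Rightarrow> (nat \<Rightarrow> nat) set"
  where "M'_set m c d =
    {x \<in> digit_seqs m. \<forall>n. lex_le c ((shift ^^ n) x) \<and> lex_le ((shift ^^ n) x) d}"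

definition M_set :: "nat \<Rightarrow> (nat \<Rightarrow> nat) \<Rightarrow> (nat \<Rightarrow> nat) \<Rightarrow> (nat \<Rightarrow> nat) set"
  where "M_set m c d =
    {x \<in> digit_seqs m. \<forall>n\<ge>1.
      lex_le c ((shift ^^ n) x) \<and> less_fun ((shift ^^ n) x) x \<and> lex_le x d}"


section \<open>The metric on sequences\<close>

lemma seq_dist_summable:
  assumes "a \<in> digit_seqs m" "b \<in> digit_seqs m"
  shows "(\<lambda>i. \<bar>real (a i) - real (b i)\<bar> / real (m + 1) ^ Suc i) summable_on UNIV"
proof -
  have le: "\<bar>real (a i) - real (b i)\<bar> \<le> real m" for i
  proof -
    have "a i \<le> m" "b i \<le> m"
      using assms by (auto simp: digit_seqs_def Pi_iff)
    then show ?thesis by linarith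
  qed
  have "summable (\<lambda>i. \<bar>real (a i) - real (b i)\<bar> / real (m + 1) ^ Suc i)"
  proof (cases "m = 0")
    case True
    then show ?thesis using le by simp
  next
    case False
    have "summable (\<lambda>i. (real m / real (m + 1)) * (1 / real (m + 1)) ^ i)"
      using False by (intro summable_mult summable_geometric) auto
    then show ?thesis
    proof (rule summable_comparison_test')
      fix i :: nat
      assume "0 \<le> i"
      have "\<bar>real (a i) - real (b i)\<bar> / real (m + 1) ^ Suc i \<le> real m / real (m + 1) ^ Suc i"
        using le by (intro divide_right_mono) auto
      then show "norm (\<bar>real (a i) - real (b i)\<bar> / real (m + 1) ^ Suc i)
          \<le> (real m / real (m + 1)) * (1 / real (m + 1)) ^ i"
        by (simp add: power_divide)
    qed
  qed
  then show ?thesis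
    by (subst summable_on_UNIV_nonneg_real_iff) auto
qed

lemma seq_dist_eq_suminf:
  assumes "a \<in> digit_seqs m" "b \<in> digit_seqs m"
  shows "seq_dist m a b = (\<Sum>i. \<bar>real (a i) - real (b i)\<bar> / real (m + 1) ^ Suc i)"
  unfolding seq_dist_def
  using has_sum_imp_sums[OF has_sum_infsum[OF seq_dist_summable[OF assms]]]
  by (simp add: sums_iff)

lemma Metric_space_seq_dist: "Metric_space (digit_seqs m) (seq_dist m)"
proof
  show "0 \<le> seq_dist m x y" for x y
    unfolding seq_dist_def by (intro infsum_nonneg) auto
  show "seq_dist m x y = seq_dist m y x" for x y
    unfolding seq_dist_def by (simp add: abs_minus_commute)
  show "seq_dist m x y = 0 \<longleftrightarrow> x = y" if "x \<in> digit_seqs m" "y \<in> digit_seqs m" for x y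
  proof
    assume "seq_dist m x y = 0"
    then have "\<bar>real (x i) - real (y i)\<bar> / real (m + 1) ^ Suc i = 0" for i
      using nonneg_infsum_le_0D[OF _ seq_dist_summable[OF that], of i]
      unfolding seq_dist_def by simp
    then show "x = y" by auto
  qed (simp add: seq_dist_def)
  show "seq_dist m x z \<le> seq_dist m x y + seq_dist m y z"
    if "x \<in> digit_seqs m" "y \<in> digit_seqs m" "z \<in> digit_seqs m" for x y z
  proof -
    have "seq_dist m x z \<le> (\<Sum>\<^sub>\<infinity>i\<in>UNIV. \<bar>real (x i) - real (y i)\<bar> / real (m + 1) ^ Suc i
        + \<bar>real (y i) - real (z i)\<bar> / real (m + 1) ^ Suc i)"
      unfolding seq_dist_def
      by (intro infsum_mono summable_on_add seq_dist_summable that)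
        (auto simp flip: add_divide_distrib intro!: divide_right_mono)
    also have "\<dots> = seq_dist m x y + seq_dist m y z"
      unfolding seq_dist_def by (intro infsum_add seq_dist_summable that)
    finally show ?thesis .
  qed
qed

end

theory Submission
  imports Defs "HOL-Library.List_Lexorder"
begin

text \<open>
  Write \<open>X\<close> for \<open>M'_set m c d\<close> and \<open>M\<close> for \<open>M_set m c d\<close>. Since \<open>M\<close> is contained in \<open>X\<close>, the point is
  that \<open>X\<close> is not larger in dimension. A point of \<open>X\<close> need not have a shift in \<open>M\<close>, because the
  supremum of its orbit need not be attained, so points of \<open>M\<close> are built from pieces of points of \<open>X\<close>.

  The bounds \<open>c\<close> and \<open>d\<close> may be replaced by the least and the greatest element of \<open>X\<close>. Then
  membership in \<open>X\<close> is decided by two counters, the lengths of the prefixes of \<open>c\<close> and of \<open>d\<close> that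
  are currently being copied, each of which is reset to \<open>0\<close> by a digit that differs from the expected
  one (\<open>M'_set_run_bounds\<close>, \<open>mem_M'_set_if_run_bounds\<close>). The set \<open>X\<close> thus consists of the infinite
  paths in a countable graph, and loops at a common state can be concatenated freely (\<open>loops_free\<close>).

  Let \<open>0 \<le> t < s\<close>. There are two kinds of points of \<open>X\<close>. If from some time on the larger counter
  is at least \<open>n\<close>, then within \<open>n\<close> steps only one of the two counters can be reset, so there are only
  two continuations of length \<open>n\<close>; for large \<open>n\<close> such points form a null set in dimension \<open>s\<close>
  (\<open>escaping_null\<close>). Otherwise some state recurs. If at every state the number of loops of length
  \<open>N\<close> is at most \<open>(m + 1) ^ (N * t)\<close>, the prefixes that end with a loop give covers which show that
  these points form a null set too (\<open>recurrent_null\<close>).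

  It remains to see that \<open>M\<close> has positive measure in dimension \<open>t\<close> if, for some state and some \<open>N\<close>,
  the set \<open>B\<close> of loops of length \<open>N\<close> has more than \<open>(m + 1) ^ (N * t)\<close> elements. Among the
  concatenations of \<open>k\<close> loops most are primitive if \<open>k\<close> is large, and the greatest rotation of a
  primitive word is a Lyndon word for the reversed order: each proper suffix is strictly smaller than
  the prefix of the same length. By the pigeonhole principle there are still many such Lyndon words that cut the same
  loop \<open>b\<close> at the same place \<open>\<rho>\<close> (\<open>ex_many_lyndon_block_words\<close>), and any concatenation of these is,
  up to a shift, a concatenation of loops, hence in \<open>X\<close>. If the greatest of these words comes first
  and never again, the sequence exceeds all its proper shifts and lies in \<open>M\<close>
  (\<open>lyndon_concatenation_in_M_set\<close>). The remaining words may be arranged arbitrarily, which yields a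
  self-similar subset of \<open>M\<close> of positive measure in dimension \<open>t\<close> (\<open>hausdorff_measure_blocks_pos\<close>).
\<close>

section \<open>Hausdorff measures\<close>

context Metric_space
begin

lemma hausdorff_premeasure_mono:
  "A \<subseteq> B \<Longrightarrow> hausdorff_premeasure s \<delta> A \<le> hausdorff_premeasure s \<delta> B"
  unfolding hausdorff_premeasure_def by (rule INF_superset_mono) auto

lemma hausdorff_measure_mono: "A \<subseteq> B \<Longrightarrow> hausdorff_measure s A \<le> hausdorff_measure s B"
  unfolding hausdorff_measure_def by (intro SUP_mono' hausdorff_premeasure_mono)

lemma hausdorff_dim_mono:
  assumes "A \<subseteq> B"
  shows "hausdorff_dim A \<le> hausdorff_dim B"
  unfolding hausdorff_dim_def
proof (rule INF_superset_mono)
  show "{s. 0 \<le> s \<and> hausdorff_measure s B = 0} \<subseteq> {s. 0 \<le> s \<and> hausdorff_measure s A = 0}"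
    using hausdorff_measure_mono[OF assms] by (metis (mono_tags, lifting) Collect_mono le_zero_eq)
qed simp

lemma hausdorff_measure_eq_0_iff:
  "hausdorff_measure s A = 0 \<longleftrightarrow> (\<forall>\<delta>>0. hausdorff_premeasure s \<delta> A = 0)"
  unfolding hausdorff_measure_def bot_ennreal[symmetric] SUP_bot_conv by auto

lemma hausdorff_dim_le_if_null_above:
  assumes "\<And>t s. 0 \<le> t \<Longrightarrow> hausdorff_measure t A = 0 \<Longrightarrow> t < s \<Longrightarrow> hausdorff_measure s B = 0"
  shows "hausdorff_dim B \<le> hausdorff_dim A"
  unfolding hausdorff_dim_def[of A]
proof (rule INF_greatest)
  fix t assume t: "t \<in> {s. 0 \<le> s \<and> hausdorff_measure s A = 0}"
  show "hausdorff_dim B \<le> ennreal t"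
  proof (rule ennreal_le_epsilon)
    fix e :: real assume "0 < e"
    then have "hausdorff_measure (t + e) B = 0" using t assms[of t "t + e"] by simp
    then have "hausdorff_dim B \<le> ennreal (t + e)"
      using t \<open>0 < e\<close> unfolding hausdorff_dim_def by (intro INF_lower) auto
    then show "hausdorff_dim B \<le> ennreal t + ennreal e"
      using t \<open>0 < e\<close> by simp
  qed
qed

lemma hausdorff_premeasure_UN_le:
  "hausdorff_premeasure s \<delta> (\<Union>n. A n) \<le> (\<Sum>n. hausdorff_premeasure s \<delta> (A n))"
proof (rule ennreal_le_epsilon)
  let ?O = "hausdorff_premeasure s \<delta>"
  fix e :: real assume "0 < e" and fin: "(\<Sum>n. ?O (A n)) < top"
  then have *: "?O (A n) < ?O (A n) + e * (1/2) ^ Suc n" for n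
    by (auto simp add: less_top dest!: ennreal_suminf_lessD)
  have "\<exists>U. (\<forall>i. U i \<subseteq> M \<and> ediam (U i) \<le> ennreal \<delta>) \<and> A n \<subseteq> (\<Union>i. U i)
      \<and> (\<Sum>i. hausdorff_gauge s (U i)) \<le> ?O (A n) + e * (1/2) ^ Suc n" for n
    using *[of n] unfolding hausdorff_premeasure_def[of s \<delta> "A n"] INF_less_iff
    by (auto intro: less_imp_le)
  then obtain U where U: "\<And>n i. U n i \<subseteq> M \<and> ediam (U n i) \<le> ennreal \<delta>"
      "\<And>n. A n \<subseteq> (\<Union>i. U n i)"
      "\<And>n. (\<Sum>i. hausdorff_gauge s (U n i)) \<le> ?O (A n) + e * (1/2) ^ Suc n"
    by metis
  define V where "V = case_prod U \<circ> prod_decode"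
  have "(\<Union>n. A n) \<subseteq> (\<Union>i. V i)"
    using U(2) by (auto simp add: V_def subset_eq) (metis prod.case prod_encode_inverse)
  then have "?O (\<Union>n. A n) \<le> (\<Sum>i. hausdorff_gauge s (V i))"
    unfolding hausdorff_premeasure_def using U(1)
    by (intro INF_lower) (auto simp: V_def split: prod.split)
  also have "\<dots> = (\<Sum>n. \<Sum>i. hausdorff_gauge s (U n i))"
  proof -
    have "(\<Sum>i. (\<lambda>p. hausdorff_gauge s (case_prod U p)) (prod_decode i)) = (\<Sum>n. \<Sum>i. hausdorff_gauge s (U n i))"
      by (rule suminf_ennreal_2dimen) simp
    then show ?thesis by (simp add: V_def)
  qed
  also have "\<dots> \<le> (\<Sum>n. ?O (A n) + e * (1/2) ^ Suc n)"
    by (intro suminf_le allI U(3)) auto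
  also have "\<dots> = (\<Sum>n. ?O (A n)) + (\<Sum>n. ennreal e * ennreal ((1/2) ^ Suc n))"
    using \<open>0 < e\<close> by (subst suminf_add[symmetric])
      (auto simp del: ennreal_suminf_cmult simp add: ennreal_mult[symmetric])
  also have "\<dots> = (\<Sum>n. ?O (A n)) + e"
    unfolding ennreal_suminf_cmult
    by (subst suminf_ennreal_eq[OF zero_le_power power_half_series]) auto
  finally show "?O (\<Union>n. A n) \<le> (\<Sum>n. ?O (A n)) + e" .
qed

lemma hausdorff_measure_UN_null:
  assumes "countable I" "\<And>i. i \<in> I \<Longrightarrow> hausdorff_measure s (A i) = 0"
  shows "hausdorff_measure s (\<Union>i\<in>I. A i) = 0"
proof (cases "I = {}")
  case True
  have "hausdorff_premeasure s \<delta> {} \<le> (\<Sum>i::nat. hausdorff_gauge s {})" if "\<delta> > 0" for \<delta>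
    unfolding hausdorff_premeasure_def by (rule INF_lower) (auto simp: ediam_def bot_ennreal)
  then show ?thesis
    using True by (simp add: hausdorff_measure_eq_0_iff hausdorff_gauge_def)
next
  case False
  show ?thesis
    unfolding hausdorff_measure_eq_0_iff
  proof (intro allI impI)
    fix \<delta> :: real assume "0 < \<delta>"
    then have null: "hausdorff_premeasure s \<delta> (A i) = 0" if "i \<in> I" for i
      using assms(2) that by (simp add: hausdorff_measure_eq_0_iff)
    have "(\<Union>i\<in>I. A i) = (\<Union>n. A (from_nat_into I n))"
      using range_from_nat_into[OF False assms(1)] by (metis image_image)
    also have "hausdorff_premeasure s \<delta> \<dots> \<le> (\<Sum>n. hausdorff_premeasure s \<delta> (A (from_nat_into I n)))"
      by (rule hausdorff_premeasure_UN_le)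
    also have "\<dots> = 0"
      using null from_nat_into[OF False] by simp
    finally show "hausdorff_premeasure s \<delta> (\<Union>i\<in>I. A i) = 0" by simp
  qed
qed

lemma hausdorff_premeasure_single:
  assumes "U \<subseteq> M" "ediam U \<le> ennreal \<delta>"
  shows "hausdorff_premeasure s \<delta> U \<le> hausdorff_gauge s U"
proof -
  have "hausdorff_premeasure s \<delta> U \<le> (\<Sum>i::nat. hausdorff_gauge s (if i = 0 then U else {}))"
    unfolding hausdorff_premeasure_def using assms
    by (intro INF_lower) (auto simp: ediam_def bot_ennreal split: if_splits)
  also have "\<dots> = (\<Sum>i\<in>{0::nat}. hausdorff_gauge s (if i = 0 then U else {}))"
    by (rule suminf_finite) (auto simp: hausdorff_gauge_def)
  finally show ?thesis by simp
qed

lemma hausdorff_premeasure_UN_finite_le: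
  assumes "finite I"
    and "\<And>i. i \<in> I \<Longrightarrow> U i \<subseteq> M \<and> ediam (U i) \<le> ennreal \<delta> \<and> hausdorff_gauge s (U i) \<le> \<epsilon>"
  shows "hausdorff_premeasure s \<delta> (\<Union>i\<in>I. U i) \<le> of_nat (card I) * \<epsilon>"
proof -
  obtain e where e: "bij_betw e {..<card I} I"
    using assms(1) ex_bij_betw_nat_finite[of I] by (auto simp: lessThan_atLeast0)
  define V where "V = (\<lambda>k. if k < card I then U (e k) else {})"
  have eI: "e k \<in> I" if "k < card I" for k using e that by (auto simp: bij_betw_def)
  have eq: "(\<Union>i\<in>I. U i) = (\<Union>k. V k)"
  proof
    show "(\<Union>i\<in>I. U i) \<subseteq> (\<Union>k. V k)"
    proof
      fix x assume "x \<in> (\<Union>i\<in>I. U i)"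
      then obtain i where "i \<in> I" "x \<in> U i" by blast
      moreover from this obtain k where "k < card I" "i = e k"
        using e by (auto simp: bij_betw_def)
      ultimately show "x \<in> (\<Union>k. V k)" by (auto simp: V_def)
    qed
    show "(\<Union>k. V k) \<subseteq> (\<Union>i\<in>I. U i)"
      using eI by (auto simp: V_def split: if_splits)
  qed
  have V0: "hausdorff_premeasure s \<delta> (V k) \<le> hausdorff_gauge s (V k)" for k
    using assms(2) eI by (intro hausdorff_premeasure_single) (auto simp: V_def ediam_def bot_ennreal)
  have "hausdorff_premeasure s \<delta> (\<Union>i\<in>I. U i) \<le> (\<Sum>k. hausdorff_premeasure s \<delta> (V k))"
    unfolding eq by (rule hausdorff_premeasure_UN_le)
  also have "\<dots> \<le> (\<Sum>k. hausdorff_gauge s (V k))"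
    by (intro suminf_le V0) auto
  also have "\<dots> = (\<Sum>k<card I. hausdorff_gauge s (V k))"
    by (rule suminf_finite) (auto simp: V_def hausdorff_gauge_def)
  also have "\<dots> \<le> (\<Sum>k<card I. \<epsilon>)"
    using assms(2) eI by (intro sum_mono) (auto simp: V_def)
  finally show ?thesis by simp
qed

lemma dist_le_ediam:
  assumes "x \<in> U" "y \<in> U" "ediam U \<le> ennreal \<delta>"
  shows "d x y \<le> enn2real (ediam U)"
proof -
  have "ennreal (d x y) \<le> ediam U"
    unfolding ediam_def using assms(1,2) by (intro SUP_upper2[of x] SUP_upper2[of y]) simp_all
  moreover have "ediam U < top"
    using assms(3) by (simp add: order_le_less_trans)
  ultimately show ?thesis
    by (metis enn2real_ennreal enn2real_mono nonneg)
qed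

text \<open>
  A cover of \<open>A\<close> pulls back along \<open>\<phi>\<close> to a cover of the unit interval by sets whose lengths are at
  most a constant times the gauges. Subadditivity of Lebesgue measure then bounds the sum of the
  gauges from below. For \<open>s = 0\<close> the inequality is not wanted, because \<open>0 powr 0 = 0\<close>; there the gauge
  of a nonempty set is \<open>1\<close>, which dominates the length of any part of the unit interval.
\<close>
lemma hausdorff_measure_pos_if_holder_inverse:
  fixes \<phi> :: "real \<Rightarrow> 'a"
  assumes "0 < C" "0 \<le> s" and in_A: "\<And>y. y \<in> {0..<1} \<Longrightarrow> \<phi> y \<in> A"
    and holder: "\<And>y y'. y \<in> {0..<1} \<Longrightarrow> y' \<in> {0..<1} \<Longrightarrow> s \<noteq> 0 \<Longrightarrow> \<bar>y - y'\<bar> \<le> C * d (\<phi> y) (\<phi> y') powr s"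
  shows "hausdorff_measure s A \<noteq> 0"
proof
  assume "hausdorff_measure s A = 0"
  then have null: "hausdorff_premeasure s 1 A = 0"
    by (simp add: hausdorff_measure_eq_0_iff)
  (* The factor 2 pays for enclosing a set of diameter D in an interval centred at one of its points,
     and max 1 C treats s = 0 together with s > 0. *)
  define K where "K = 2 * max 1 C"
  have "1 / ennreal K \<le> hausdorff_premeasure s 1 A"
    unfolding hausdorff_premeasure_def
  proof (rule INF_greatest)
    fix U :: "nat \<Rightarrow> 'a set"
    assume "U \<in> {U. (\<forall>i. U i \<subseteq> M \<and> ediam (U i) \<le> ennreal 1) \<and> A \<subseteq> (\<Union>i. U i)}"
    then have U: "\<And>i. ediam (U i) \<le> ennreal 1" "A \<subseteq> (\<Union>i. U i)" by auto
    define V where "V i = {y \<in> {0..<1}. \<phi> y \<in> U i}" for i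
    have "\<exists>I \<in> sets lborel. V i \<subseteq> I \<and> emeasure lborel I \<le> ennreal K * hausdorff_gauge s (U i)" for i
    proof (cases "V i = {}")
      case True
      then show ?thesis by (intro bexI[of _ "{}"]) auto
    next
      case False
      then obtain y0 where y0: "y0 \<in> V i" by blast
      define r where "r = (if s = 0 then 1 else enn2real (ediam (U i)) powr s)"
      have "r \<ge> 0" by (simp add: r_def)
      have gauge: "hausdorff_gauge s (U i) = ennreal r"
        using y0 by (auto simp: hausdorff_gauge_def r_def V_def)
      have "\<bar>y - y0\<bar> \<le> max 1 C * r" if "y \<in> V i" for y
      proof (cases "s = 0")
        case True
        then have "\<bar>y - y0\<bar> \<le> 1" using that y0 by (auto simp: V_def)
        then show ?thesis using True by (simp add: r_def)
      next
        case False
        have "d (\<phi> y) (\<phi> y0) \<le> enn2real (ediam (U i))"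
          using that y0 by (intro dist_le_ediam[OF _ _ U(1)[of i]]) (auto simp: V_def)
        then have "d (\<phi> y) (\<phi> y0) powr s \<le> r"
          using False assms(2) by (auto simp: r_def intro!: powr_mono2)
        then have "C * d (\<phi> y) (\<phi> y0) powr s \<le> max 1 C * r"
          using \<open>0 < C\<close> by (intro mult_mono) auto
        then show ?thesis
          using holder[of y y0] that y0 False by (auto simp: V_def)
      qed
      then have "V i \<subseteq> {y0 - max 1 C * r .. y0 + max 1 C * r}"
        by (auto simp: abs_le_iff) (smt (verit))+
      moreover have "emeasure lborel {y0 - max 1 C * r .. y0 + max 1 C * r}
          = ennreal K * hausdorff_gauge s (U i)"
        using \<open>r \<ge> 0\<close> unfolding gauge K_def
        by (subst emeasure_lborel_Icc) (auto simp: ennreal_mult[symmetric] algebra_simps)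
      ultimately show ?thesis
        by (intro bexI[of _ "{y0 - max 1 C * r .. y0 + max 1 C * r}"]) auto
    qed
    then obtain I where I: "\<And>i. I i \<in> sets lborel" "\<And>i. V i \<subseteq> I i"
        "\<And>i. emeasure lborel (I i) \<le> ennreal K * hausdorff_gauge s (U i)"
      by metis
    have "{0..<1} \<subseteq> (\<Union>i. I i)"
    proof
      fix y :: real assume "y \<in> {0..<1}"
      then obtain i where "y \<in> V i" using in_A U(2) by (auto simp: V_def)
      then show "y \<in> (\<Union>i. I i)" using I(2) by blast
    qed
    then have "emeasure lborel {0..<1::real} \<le> emeasure lborel (\<Union>i. I i)"
      using I(1) by (intro emeasure_mono) auto
    also have "\<dots> \<le> (\<Sum>i. emeasure lborel (I i))"
      using I(1) by (intro emeasure_subadditive_countably) auto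
    also have "\<dots> \<le> (\<Sum>i. ennreal K * hausdorff_gauge s (U i))"
      by (intro suminf_le I(3)) auto
    finally have "1 \<le> ennreal K * (\<Sum>i. hausdorff_gauge s (U i))"
      by simp
    moreover have "0 < ennreal K" by (simp add: K_def)
    ultimately show "1 / ennreal K \<le> (\<Sum>i. hausdorff_gauge s (U i))"
      by (meson divide_le_posI_ennreal)
  qed
  then show False
    using null by (simp add: K_def ennreal_divide_eq_0_iff)
qed

end

section \<open>Cylinders and null sets of digit sequences\<close>

abbreviation seq_hausdorff_measure :: "nat \<Rightarrow> real \<Rightarrow> (nat \<Rightarrow> nat) set \<Rightarrow> ennreal"
  where "seq_hausdorff_measure m \<equiv> Metric_space.hausdorff_measure (digit_seqs m) (seq_dist m)"

lemma power_powr_swap: "0 < a \<Longrightarrow> (a ^ j) powr s = (a powr s) ^ j" for a :: real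
  by (simp add: powr_realpow[symmetric] powr_powr powr_power mult.commute)

definition take_seq :: "nat \<Rightarrow> (nat \<Rightarrow> 'a) \<Rightarrow> 'a list"
  where "take_seq n x = map x [0..<n]"

lemma length_take_seq [simp]: "length (take_seq n x) = n"
  by (simp add: take_seq_def)

lemma nth_take_seq [simp]: "i < n \<Longrightarrow> take_seq n x ! i = x i"
  by (simp add: take_seq_def)

lemma take_seq_eq_iff: "take_seq n x = take_seq n y \<longleftrightarrow> (\<forall>i<n. x i = y i)"
  by (auto simp: take_seq_def)

lemma take_seq_add: "take_seq (k + n) x = take_seq k x @ take_seq n (\<lambda>i. x (k + i))"
  by (rule nth_equalityI) (auto simp: nth_append)

lemma finite_digit_words: "finite {w. set w \<subseteq> {0..m::nat} \<and> length w = n}"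
  by (rule finite_lists_length_eq) simp

lemma card_digit_words: "card {w. set w \<subseteq> {0..m::nat} \<and> length w = n} = (m + 1) ^ n"
  by (simp add: card_lists_length_eq)

lemma take_seq_digits: "x \<in> digit_seqs m \<Longrightarrow> set (take_seq n x) \<subseteq> {0..m}"
  by (auto simp: take_seq_def digit_seqs_def)

lemma shift_power: "(shift ^^ n) x = (\<lambda>i. x (n + i))"
  by (induction n) (auto simp: shift_def)

lemma shift_digit_seqs: "x \<in> digit_seqs m \<Longrightarrow> (\<lambda>i. x (n + i)) \<in> digit_seqs m"
  by (auto simp: digit_seqs_def)

lemma seq_dist_ge_if_neq:
  assumes "x \<in> digit_seqs m" "y \<in> digit_seqs m" "x p \<noteq> y p" "p < n"
  shows "1 / real (m + 1) ^ n \<le> seq_dist m x y"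
proof -
  have "1 / real (m + 1) ^ n \<le> 1 / real (m + 1) ^ Suc p"
    using assms(4) by (intro divide_left_mono power_increasing) auto
  also have "\<dots> \<le> \<bar>real (x p) - real (y p)\<bar> / real (m + 1) ^ Suc p"
    using assms(3) by (intro divide_right_mono) auto
  also have "\<dots> = (\<Sum>\<^sub>\<infinity>i\<in>{p}. \<bar>real (x i) - real (y i)\<bar> / real (m + 1) ^ Suc i)"
    by simp
  also have "\<dots> \<le> seq_dist m x y"
    unfolding seq_dist_def
    by (rule infsum_mono2) (use seq_dist_summable[OF assms(1,2)] in auto)
  finally show ?thesis .
qed

lemma seq_dist_le_if_agree:
  assumes "1 \<le> m" "x \<in> digit_seqs m" "y \<in> digit_seqs m" "take_seq n x = take_seq n y"
  shows "seq_dist m x y \<le> 1 / real (m + 1) ^ n"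
proof -
  let ?f = "\<lambda>i. \<bar>real (x i) - real (y i)\<bar> / real (m + 1) ^ Suc i"
  let ?g = "\<lambda>i. (real m / real (m + 1) ^ Suc n) * (1 / real (m + 1)) ^ i"
  have sf: "summable ?f"
    using seq_dist_summable[OF assms(2,3)]
    by (subst (asm) summable_on_UNIV_nonneg_real_iff) auto
  have le: "\<bar>real (x i) - real (y i)\<bar> \<le> real m" for i
  proof -
    have "x i \<le> m" "y i \<le> m"
      using assms by (auto simp: digit_seqs_def Pi_iff)
    then show ?thesis by linarith
  qed
  have sg: "?g sums ((real m / real (m + 1) ^ Suc n) * (1 / (1 - 1 / real (m + 1))))"
    using assms(1) by (intro sums_mult geometric_sums) auto
  have "seq_dist m x y = (\<Sum>i. ?f (i + n)) + (\<Sum>i<n. ?f i)"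
    unfolding seq_dist_eq_suminf[OF assms(2,3)] by (rule suminf_split_initial_segment[OF sf])
  also have "(\<Sum>i<n. ?f i) = 0"
    using assms(4) by (intro sum.neutral) (auto simp: take_seq_eq_iff)
  also have "(\<Sum>i. ?f (i + n)) \<le> (\<Sum>i. ?g i)"
  proof (rule suminf_le)
    fix i
    have "?f (i + n) \<le> real m / real (m + 1) ^ Suc (i + n)"
      using le by (intro divide_right_mono) auto
    also have "\<dots> = ?g i"
      by (simp add: power_add power_divide mult_ac)
    finally show "?f (i + n) \<le> ?g i" .
  next
    show "summable (\<lambda>i. ?f (i + n))" by (rule summable_ignore_initial_segment[OF sf])
    show "summable ?g" using sg by (rule sums_summable)
  qed
  also have "(\<Sum>i. ?g i) = 1 / real (m + 1) ^ n"
  proof -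
    have "(real m / real (m + 1) ^ Suc n) * (1 / (1 - 1 / real (m + 1))) = 1 / real (m + 1) ^ n"
      using assms(1) by (simp add: divide_simps)
    then show ?thesis using sums_unique[OF sg] by simp
  qed
  finally show ?thesis by simp
qed

text \<open>
  The convergence part of the Borel--Cantelli lemma: if every point of \<open>A\<close> has infinitely many
  prefixes in the finite sets \<open>P r\<close>, then every tail of the family of cylinders over these words
  covers \<open>A\<close>, and the tails of a convergent series tend to \<open>0\<close>.
\<close>
lemma seq_hausdorff_null_if_covered:
  fixes P :: "nat \<Rightarrow> nat list set"
  assumes "1 \<le> m" "0 < s" "A \<subseteq> digit_seqs m"
    and P: "\<And>r. finite (P r)" "\<And>r w. w \<in> P r \<Longrightarrow> length w = \<tau> r" "\<And>r. r \<le> \<tau> r"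
    and cover: "\<And>x n. x \<in> A \<Longrightarrow> \<exists>r\<ge>n. take_seq (\<tau> r) x \<in> P r"
    and summable: "summable (\<lambda>r. real (card (P r)) * (1 / real (m + 1) ^ \<tau> r) powr s)"
  shows "seq_hausdorff_measure m s A = 0"
proof -
  interpret Metric_space "digit_seqs m" "seq_dist m" by (rule Metric_space_seq_dist)
  let ?f = "\<lambda>r. real (card (P r)) * (1 / real (m + 1) ^ \<tau> r) powr s"
  define cyl where "cyl w = {x \<in> digit_seqs m. take_seq (length w) x = w}" for w
  have ediam_cyl: "ediam (cyl w) \<le> ennreal (1 / real (m + 1) ^ length w)" for w
    unfolding ediam_def
    by (intro SUP_least ennreal_leI seq_dist_le_if_agree assms(1)) (auto simp: cyl_def)
  have gauge_cyl: "hausdorff_gauge s (cyl w) \<le> ennreal ((1 / real (m + 1) ^ length w) powr s)" for w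
    using assms(2) ediam_cyl[of w]
    by (auto simp: hausdorff_gauge_def intro!: ennreal_leI powr_mono2 enn2real_leI)
  have small: "hausdorff_premeasure s \<delta> A \<le> ennreal \<epsilon>" if "0 < \<delta>" "0 < \<epsilon>" for \<delta> \<epsilon>
  proof -
    have "(\<lambda>r. (1 / real (m + 1)) ^ r) \<longlonglongrightarrow> 0"
      using assms(1) by (intro LIMSEQ_power_zero) auto
    from LIMSEQ_D[OF this \<open>0 < \<delta>\<close>]
    obtain n1 where n1: "\<And>r. r \<ge> n1 \<Longrightarrow> (1 / real (m + 1)) ^ r \<le> \<delta>"
      by (auto simp: power_divide intro: less_imp_le)
    obtain n2 where n2: "\<And>n. n \<ge> n2 \<Longrightarrow> norm (\<Sum>r. ?f (r + n)) < \<epsilon>"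
      using suminf_exist_split[OF \<open>0 < \<epsilon>\<close> summable] by blast
    define n where "n = max n1 n2"
    have "A \<subseteq> (\<Union>r. \<Union>w\<in>P (r + n). cyl w)"
    proof
      fix x assume "x \<in> A"
      then obtain r where r: "r \<ge> n" "take_seq (\<tau> r) x \<in> P r" using cover by blast
      have "x \<in> cyl (take_seq (\<tau> r) x)" using \<open>x \<in> A\<close> assms(3) by (auto simp: cyl_def)
      moreover have "r = (r - n) + n" using r(1) by simp
      ultimately show "x \<in> (\<Union>r. \<Union>w\<in>P (r + n). cyl w)" using r(2) by (metis UN_iff UNIV_I)
    qed
    then have "hausdorff_premeasure s \<delta> A \<le> hausdorff_premeasure s \<delta> (\<Union>r. \<Union>w\<in>P (r + n). cyl w)"
      by (rule hausdorff_premeasure_mono)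
    also have "\<dots> \<le> (\<Sum>r. hausdorff_premeasure s \<delta> (\<Union>w\<in>P (r + n). cyl w))"
      by (rule hausdorff_premeasure_UN_le)
    also have "\<dots> \<le> (\<Sum>r. ennreal (?f (r + n)))"
    proof (rule suminf_le)
      fix r
      have "hausdorff_premeasure s \<delta> (\<Union>w\<in>P (r + n). cyl w)
          \<le> of_nat (card (P (r + n))) * ennreal ((1 / real (m + 1) ^ \<tau> (r + n)) powr s)"
      proof (rule hausdorff_premeasure_UN_finite_le[OF P(1)], intro conjI)
        fix w assume w: "w \<in> P (r + n)"
        show "cyl w \<subseteq> digit_seqs m" by (auto simp: cyl_def)
        have "1 / real (m + 1) ^ length w \<le> (1 / real (m + 1)) ^ (r + n)"
          using P(2)[OF w] P(3)[of "r + n"] by (auto simp: power_divide intro!: divide_left_mono power_increasing)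
        also have "\<dots> \<le> \<delta>" by (rule n1) (simp add: n_def)
        finally show "ediam (cyl w) \<le> ennreal \<delta>"
          using ediam_cyl[of w] by (meson ennreal_leI order_trans)
        show "hausdorff_gauge s (cyl w) \<le> ennreal ((1 / real (m + 1) ^ \<tau> (r + n)) powr s)"
          using gauge_cyl[of w] P(2)[OF w] by simp
      qed
      also have "\<dots> = ennreal (?f (r + n))"
        by (simp add: ennreal_mult ennreal_of_nat_eq_real_of_nat)
      finally show "hausdorff_premeasure s \<delta> (\<Union>w\<in>P (r + n). cyl w) \<le> ennreal (?f (r + n))" .
    qed auto
    also have "\<dots> = ennreal (\<Sum>r. ?f (r + n))"
      using summable by (intro suminf_ennreal2 summable_ignore_initial_segment) auto
    also have "\<dots> \<le> ennreal \<epsilon>"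
      using n2[of n] by (intro ennreal_leI) (auto simp: n_def)
    finally show ?thesis .
  qed
  have "hausdorff_premeasure s \<delta> A = 0" if "0 < \<delta>" for \<delta>
  proof -
    have "hausdorff_premeasure s \<delta> A \<le> 0"
    proof (rule ennreal_le_epsilon)
      fix e :: real assume "0 < e"
      then show "hausdorff_premeasure s \<delta> A \<le> 0 + ennreal e" using small[OF that] by simp
    qed
    then show ?thesis by simp
  qed
  then show ?thesis
    unfolding hausdorff_measure_eq_0_iff by blast
qed

section \<open>Concatenations of words and positive Hausdorff measure\<close>

text \<open>
  The infinite concatenation \<open>ls 0 @ ls 1 @ \<dots>\<close> of words of the common length \<open>L\<close>.
\<close>
definition blocks :: "nat \<Rightarrow> (nat \<Rightarrow> 'a list) \<Rightarrow> nat \<Rightarrow> 'a"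
  where "blocks L ls = (\<lambda>p. ls (p div L) ! (p mod L))"

lemma blocks_eq_imp_eq:
  assumes "\<And>p. p < n * L \<Longrightarrow> blocks L ls p = blocks L ls' p" "q < n"
    and "length (ls q) = L" "length (ls' q) = L"
  shows "ls q = ls' q"
proof (rule nth_equalityI)
  fix r assume r: "r < length (ls q)"
  then have rL: "r < L" using assms(3) by simp
  have "q * L + r < Suc q * L" using rL by simp
  also have "\<dots> \<le> n * L" using assms(2) by (intro mult_right_mono) auto
  finally have "blocks L ls (q * L + r) = blocks L ls' (q * L + r)" by (rule assms(1))
  then show "ls q ! r = ls' q ! r" using rL by (simp add: blocks_def)
qed (simp add: assms)

lemma blocks_in_digit_seqs:
  assumes "0 < L" "\<And>q. set (ls q) \<subseteq> {0..m} \<and> length (ls q) = L"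
  shows "blocks L ls \<in> digit_seqs m"
proof -
  have "blocks L ls p \<in> {0..m}" for p
  proof -
    have "ls (p div L) ! (p mod L) \<in> set (ls (p div L))"
      using assms by (intro nth_mem) simp
    then show ?thesis using assms(2)[of "p div L"] by (auto simp: blocks_def)
  qed
  then show ?thesis by (auto simp: digit_seqs_def)
qed

lemma floor_eq_if_digits_eq:
  fixes y y' :: real
  assumes "2 \<le> g" "y \<in> {0..<1}" "y' \<in> {0..<1}"
    and "\<And>k. k < n \<Longrightarrow> \<lfloor>y * real g ^ Suc k\<rfloor> mod int g = \<lfloor>y' * real g ^ Suc k\<rfloor> mod int g"
  shows "\<lfloor>y * real g ^ n\<rfloor> = \<lfloor>y' * real g ^ n\<rfloor>"
  using assms(4)
proof (induction n)
  case 0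
  have "\<lfloor>y\<rfloor> = 0" "\<lfloor>y'\<rfloor> = 0" using assms by (auto simp: floor_eq_iff)
  then show ?case by simp
next
  case (Suc n)
  have div: "\<lfloor>z * real g ^ n\<rfloor> = \<lfloor>z * real g ^ Suc n\<rfloor> div int g" for z :: real
  proof -
    have "\<lfloor>z * real g ^ Suc n / real_of_int (int g)\<rfloor> = \<lfloor>z * real g ^ Suc n\<rfloor> div int g"
      by (rule floor_divide_real_eq_div) simp
    moreover have "z * real g ^ Suc n / real_of_int (int g) = z * real g ^ n"
      using assms(1) by simp
    ultimately show ?thesis by simp
  qed
  have "\<lfloor>y * real g ^ n\<rfloor> = \<lfloor>y' * real g ^ n\<rfloor>"
    using Suc.prems by (intro Suc.IH) auto
  then have "\<lfloor>y * real g ^ Suc n\<rfloor> div int g = \<lfloor>y' * real g ^ Suc n\<rfloor> div int g"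
    unfolding div .
  then show ?case
    using Suc.prems[of n] by (metis div_mult_mod_eq lessI)
qed


text \<open>
  Let \<open>g\<close> be the number of words in \<open>E\<close>. A real number in the unit interval is sent to the
  concatenation spelled by its base-\<open>g\<close> digits. Two reals at distance \<open>g\<^sup>-\<^sup>n\<close> or more differ in
  one of their first \<open>n\<close> digits, so their images differ in one of the first \<open>n + 1\<close> blocks and have
  distance at least \<open>(m + 1) ^ - ((n + 1) * L)\<close>. Since \<open>(m + 1) ^ (L * s) \<le> g\<close>, the inverse map is
  \<open>s\<close>-Hoelder. The word \<open>v\<close> in front is there because a member of \<open>M_set\<close> needs a prefix that
  exceeds everything after it.
\<close>
lemma hausdorff_measure_blocks_pos:
  fixes E :: "nat list set"
  assumes "0 < L" "0 \<le> s" "finite E" "2 \<le> card E"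
    and card_ge: "(real (m + 1) ^ L) powr s \<le> real (card E)"
    and E: "\<And>w. w \<in> insert v E \<Longrightarrow> set w \<subseteq> {0..m} \<and> length w = L"
    and A: "\<And>ls. ls 0 = v \<Longrightarrow> (\<And>q. ls (Suc q) \<in> E) \<Longrightarrow> blocks L ls \<in> A"
  shows "seq_hausdorff_measure m s A \<noteq> 0"
proof -
  interpret Metric_space "digit_seqs m" "seq_dist m" by (rule Metric_space_seq_dist)
  define g where "g = card E"
  have g2: "2 \<le> g" using assms(4) by (simp add: g_def)
  obtain e where e: "bij_betw e {..<g} E"
    using assms(3) ex_bij_betw_nat_finite[of E] by (auto simp: g_def lessThan_atLeast0)
  define dig where "dig y k = nat (\<lfloor>y * real g ^ Suc k\<rfloor> mod int g)" for y :: real and k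
  define word where "word y q = (case q of 0 \<Rightarrow> v | Suc k \<Rightarrow> e (dig y k))" for y q
  have dig_less: "dig y k < g" for y k
    using g2 by (simp add: dig_def nat_less_iff)
  have eE: "e (dig y k) \<in> E" for y k
    using e dig_less by (auto simp: bij_betw_def)
  have word: "set (word y q) \<subseteq> {0..m} \<and> length (word y q) = L" for y q
    using E eE by (auto simp: word_def split: nat.split)
  show ?thesis
  proof (rule hausdorff_measure_pos_if_holder_inverse[of "real g ^ 2" _ "\<lambda>y. blocks L (word y)"])
    show "0 < real g ^ 2" "0 \<le> s" using g2 assms(2) by auto
    show "blocks L (word y) \<in> A" for y
      using eE by (intro A) (auto simp: word_def)
    fix y y' :: real assume y: "y \<in> {0..<1}" "y' \<in> {0..<1}" and "s \<noteq> 0"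
    show "\<bar>y - y'\<bar> \<le> real g ^ 2 * seq_dist m (blocks L (word y)) (blocks L (word y')) powr s"
    proof (cases "y = y'")
      case False
      define h where "h = \<bar>y - y'\<bar>"
      have h: "0 < h" "h < 1" using False y by (auto simp: h_def)
      obtain n0 where "(1 / real g) ^ n0 < h"
        using real_arch_pow_inv[OF h(1), of "1 / real g"] g2 by auto
      (* The scale of h: g^-n <= h < g^-(n-1). The constant g^2 of the Hoelder estimate absorbs the two
         extra factors g lost by passing from n - 1 to the n + 1 blocks v, e, ..., e. *)
      define n where "n = (LEAST n. (1 / real g) ^ n \<le> h)"
      have n: "(1 / real g) ^ n \<le> h"
        unfolding n_def by (rule LeastI[of _ n0]) (use \<open>(1 / real g) ^ n0 < h\<close> in simp)
      have "n \<noteq> 0" using n h(2) by (intro notI) simp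
      then obtain k where k: "n = Suc k" by (cases n) auto
      have hk: "h < (1 / real g) ^ k"
        using not_less_Least[of k "\<lambda>n. (1 / real g) ^ n \<le> h"] k by (simp add: n_def)
      have "\<exists>p < Suc n * L. blocks L (word y) p \<noteq> blocks L (word y') p"
      proof (rule ccontr)
        assume "\<not> ?thesis"
        then have agree: "blocks L (word y) p = blocks L (word y') p" if "p < Suc n * L" for p
          using that by blast
        have "\<lfloor>y * real g ^ Suc k\<rfloor> mod int g = \<lfloor>y' * real g ^ Suc k\<rfloor> mod int g" if "k < n" for k
        proof -
          have "word y (Suc k) = word y' (Suc k)"
            by (rule blocks_eq_imp_eq[of "Suc n" L]) (use agree that word in auto)
          then have "dig y k = dig y' k"
            using e dig_less by (auto simp: word_def bij_betw_def dest: inj_onD)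
          then show ?thesis using g2 by (simp add: dig_def nat_eq_iff)
        qed
        then have "\<lfloor>y * real g ^ n\<rfloor> = \<lfloor>y' * real g ^ n\<rfloor>"
          by (intro floor_eq_if_digits_eq g2 y)
        then have "\<bar>y * real g ^ n - y' * real g ^ n\<bar> < 1" by linarith
        then have "h * real g ^ n < 1"
          by (simp add: h_def left_diff_distrib[symmetric] abs_mult)
        then show False
          using n g2 by (simp add: power_divide divide_simps split: if_splits)
      qed
      then obtain p where p: "p < Suc n * L" "blocks L (word y) p \<noteq> blocks L (word y') p" by blast
      have "1 / real (m + 1) ^ (Suc n * L) \<le> seq_dist m (blocks L (word y)) (blocks L (word y'))"
        by (rule seq_dist_ge_if_neq[where p = p]) (use p word assms(1) in \<open>auto intro!: blocks_in_digit_seqs\<close>)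
      then have "(1 / real (m + 1) ^ (Suc n * L)) powr s
          \<le> seq_dist m (blocks L (word y)) (blocks L (word y')) powr s"
        using assms(2) by (intro powr_mono2) auto
      moreover have "1 / real g ^ Suc n \<le> (1 / real (m + 1) ^ (Suc n * L)) powr s"
      proof -
        have "(real (m + 1) ^ (Suc n * L)) powr s = ((real (m + 1) ^ L) ^ Suc n) powr s"
          by (metis power_mult mult.commute)
        also have "\<dots> = ((real (m + 1) ^ L) powr s) ^ Suc n"
          by (rule power_powr_swap) simp
        also have "\<dots> \<le> real g ^ Suc n"
          using card_ge by (intro power_mono) (auto simp: g_def)
        finally show ?thesis
          using g2 by (subst powr_divide) (auto intro!: divide_left_mono)
      qed
      moreover have "h \<le> real g ^ 2 * (1 / real g ^ Suc n)"
        using hk g2 k by (simp add: power_divide power2_eq_square)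
      ultimately show ?thesis
        unfolding h_def[symmetric] using g2
        by (smt (verit) mult_left_mono zero_le_power of_nat_0_le_iff)
    qed simp
  qed
qed

section \<open>Runs along a bounding sequence\<close>

text \<open>
  An automaton that reads \<open>x\<close> and keeps the length of the prefix of \<open>c\<close> that is currently being
  matched, starting with a match of length \<open>i\<close>. A mismatch restarts at \<open>0\<close> and ignores shorter
  matches. This is justified when \<open>c\<close> is the smallest of its shifts and the mismatching digit is too
  large: the digits that \<open>c\<close> expects after the shorter matches are no larger than the one missed, so
  these matches break too. Hence two such runs, one for the lower and one for the upper bound, decide
  membership in \<open>M'_set\<close>, and a pair of run lengths determines which continuations are possible.
\<close>
fun run :: "(nat \<Rightarrow> 'a) \<Rightarrow> nat \<Rightarrow> (nat \<Rightarrow> 'a) \<Rightarrow> nat \<Rightarrow> nat"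
  where
    "run c i x 0 = i"
  | "run c i x (Suc t) = (if x t = c (run c i x t) then Suc (run c i x t) else 0)"

lemma run_cong: "(\<And>k. k < t \<Longrightarrow> x k = y k) \<Longrightarrow> run c i x t = run c i y t"
  by (induction t) auto

lemma run_add: "run c i x (t + r) = run c (run c i x t) (\<lambda>k. x (t + k)) r"
  by (induction r) auto

lemma run_le: "run c i x t \<le> i + t"
  by (induction t) auto

lemma run_matches:
  "s < t \<Longrightarrow> s < run c i x t \<Longrightarrow> x (t - Suc s) = c (run c i x t - Suc s)"
proof (induction t arbitrary: s)
  case (Suc t)
  then show ?case by (cases s) (auto split: if_splits)
qed simp

text \<open>
  As long as no mismatch occurs, the sequence is forced to copy \<open>c\<close>.
\<close>
lemma run_follow:
  assumes "\<And>r. r < n \<Longrightarrow> x (t + r) = c (run c i x (t + r))"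
  shows "take_seq n (\<lambda>r. x (t + r)) = take_seq n (\<lambda>r. c (run c i x t + r))"
proof -
  have "run c i x (t + r) = run c i x t + r" if "r \<le> n" for r
    using that assms by (induction r) auto
  then show ?thesis using assms by (auto simp: take_seq_eq_iff)
qed

text \<open>
  The lower and the upper bound are treated together: what is proved here about \<open><\<close> is applied to
  the reversed order of the digits as well, which turns lower bounds into upper bounds.
\<close>
context linorder
begin

definition seq_less :: "(nat \<Rightarrow> 'a) \<Rightarrow> (nat \<Rightarrow> 'a) \<Rightarrow> bool"
  where "seq_less x y \<longleftrightarrow> (\<exists>k. x k < y k \<and> (\<forall>l<k. x l = y l))"

lemma run_le_if_shifts_not_less:
  assumes "\<And>n. \<not> seq_less (\<lambda>k. x (n + k)) c"
  shows "c (run c 0 x t) \<le> x t"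
proof (rule ccontr)
  let ?i = "run c 0 x t"
  assume "\<not> ?thesis"
  moreover have "?i \<le> t" using run_le[of c 0 x t] by simp
  moreover have "x (t - ?i + l) = c l" if "l < ?i" for l
    using run_matches[of "?i - Suc l" t c 0 x] that \<open>?i \<le> t\<close>
    by (auto simp: Suc_diff_Suc)
  ultimately have "seq_less (\<lambda>k. x (t - ?i + k)) c"
    unfolding seq_less_def by (intro exI[of _ ?i]) auto
  then show False using assms by blast
qed

text \<open>
  Suppose that some shift of \<open>x\<close> drops below \<open>c\<close> at its digit \<open>k\<close>. Along this shift the run always has
  length at least that of the match, so when digit \<open>k\<close> is read the run has matched a prefix of \<open>c\<close>
  that ends with \<open>c 0, \<dots>, c (k - 1)\<close>. As \<open>c\<close> is the smallest of its shifts, the digit \<open>c\<close> expects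
  after that prefix is at least \<open>c k\<close>, and \<open>x\<close> has fallen below it. The run may start with any
  length \<open>i\<close>, because the argument looks only at digits of \<open>x\<close> itself.
\<close>
lemma shifts_not_less_if_run_le:
  assumes adm: "\<And>n. \<not> seq_less (\<lambda>k. c (n + k)) c"
    and legal: "\<And>t. c (run c i x t) \<le> x t"
  shows "\<not> seq_less (\<lambda>k. x (n + k)) c"
proof
  assume "seq_less (\<lambda>k. x (n + k)) c"
  then obtain k where k: "x (n + k) < c k" "\<And>l. l < k \<Longrightarrow> x (n + l) = c l"
    by (auto simp: seq_less_def)
  have key: "c l \<le> c (run c i x (n + l))" if "l \<le> k" "l \<le> run c i x (n + l)" for l
  proof (rule ccontr)
    let ?j = "run c i x (n + l)"
    assume "\<not> ?thesis"
    moreover have "c (?j - l + r) = c r" if "r < l" for r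
    proof -
      have "x (n + l - Suc (l - Suc r)) = c (?j - Suc (l - Suc r))"
        using that \<open>l \<le> ?j\<close> by (intro run_matches) auto
      moreover have "n + l - Suc (l - Suc r) = n + r" "?j - Suc (l - Suc r) = ?j - l + r"
        using that \<open>l \<le> ?j\<close> by auto
      ultimately show ?thesis using k(2)[of r] that \<open>l \<le> k\<close> by simp
    qed
    ultimately have "seq_less (\<lambda>r. c (?j - l + r)) c"
      unfolding seq_less_def using \<open>l \<le> ?j\<close> by (intro exI[of _ l]) auto
    then show False using adm by blast
  qed
  have "l \<le> run c i x (n + l)" if "l \<le> k" for l
    using that
  proof (induction l)
    case (Suc l)
    then have "c l \<le> c (run c i x (n + l))" by (intro key) auto
    moreover have "x (n + l) = c l" using Suc.prems by (intro k) auto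
    ultimately have "x (n + l) = c (run c i x (n + l))"
      using legal[of "n + l"] by simp
    then show ?case using Suc by simp
  qed simp
  then have "c k \<le> c (run c i x (n + k))" by (intro key) auto
  then show False using legal[of "n + k"] k(1) by simp
qed

text \<open>
  Keep, for each \<open>n\<close> in turn, only the sequences with the least digit \<open>n\<close> among those still present.
  The digits chosen form a sequence all of whose prefixes are prefixes of members of \<open>A\<close>.
\<close>
lemma ex_seq_minimal:
  fixes A :: "(nat \<Rightarrow> 'a) set"
  assumes "A \<noteq> {}" "finite F" "\<And>x k. x \<in> A \<Longrightarrow> x k \<in> F"
    and closed: "\<And>z. (\<And>n. \<exists>x\<in>A. \<forall>k<n. x k = z k) \<Longrightarrow> z \<in> A"
  shows "\<exists>z\<in>A. \<forall>x\<in>A. \<not> seq_less x z"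
proof -
  define S where "S = rec_nat A (\<lambda>n T. {x \<in> T. \<forall>y\<in>T. x n \<le> y n})"
  have S_0: "S 0 = A" and S_Suc: "S (Suc n) = {x \<in> S n. \<forall>y\<in>S n. x n \<le> y n}" for n
    by (simp_all add: S_def)
  have S_sub: "S n \<subseteq> A" for n
    by (induction n) (auto simp: S_0 S_Suc)
  have S_ne: "S n \<noteq> {}" for n
  proof (induction n)
    case (Suc n)
    let ?V = "(\<lambda>x. x n) ` S n"
    have "finite ?V" using assms(2,3) S_sub by (meson finite_subset image_subset_iff subsetD)
    then have "Min ?V \<in> ?V" using Suc by (intro Min_in) auto
    then obtain x where "x \<in> S n" "x n = Min ?V" by auto
    then have "x \<in> S (Suc n)" using \<open>finite ?V\<close> by (auto simp: S_Suc)
    then show ?case by blast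
  qed (simp add: S_0 assms(1))
  define z where "z n = (SOME x. x \<in> S (Suc n)) n" for n
  have z: "x \<in> S (Suc n) \<Longrightarrow> x n = z n" for x n
  proof -
    assume x: "x \<in> S (Suc n)"
    have "(SOME x. x \<in> S (Suc n)) \<in> S (Suc n)" using S_ne by (simp add: some_in_eq)
    then show "x n = z n" using x by (auto simp: z_def S_Suc intro: order.antisym)
  qed
  have agree: "\<forall>k<n. x k = z k" if "x \<in> S n" for x n
    using that
  proof (induction n)
    case (Suc n)
    then show ?case using z[of x n] by (auto simp: S_Suc less_Suc_eq)
  qed simp
  have "z \<in> A"
    using S_ne S_sub agree by (intro closed) blast
  moreover have "\<not> seq_less x z" if "x \<in> A" for x
  proof
    assume "seq_less x z"
    then obtain k where k: "x k < z k" "\<forall>l<k. x l = z l" by (auto simp: seq_less_def)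
    have le: "z l \<le> y l" if "y \<in> S l" for y l
    proof -
      obtain v where v: "v \<in> S (Suc l)" using S_ne by blast
      then show ?thesis using z[OF v] that by (auto simp: S_Suc)
    qed
    have "x \<in> S l" if "l \<le> k" for l
      using that
    proof (induction l)
      case (Suc l)
      then show ?case using le k(2) by (auto simp: S_Suc)
    qed (simp add: S_0 \<open>x \<in> A\<close>)
    then show False using le[of x k] k(1) by simp
  qed
  ultimately show ?thesis by blast
qed

end

section \<open>The sets between two bounding sequences\<close>

lemma seq_less_iff: "seq_less x y \<longleftrightarrow> less_fun x y"
  by (simp add: seq_less_def less_fun_def)

lemma dual_seq_less_iff: "linorder.seq_less (>) x y \<longleftrightarrow> less_fun y x"
  by (auto simp: linorder.seq_less_def[OF dual_linorder] less_fun_def)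

lemma less_fun_total:
  fixes x y :: "nat \<Rightarrow> 'a::linorder"
  assumes "x \<noteq> y"
  shows "less_fun x y \<or> less_fun y x"
proof -
  obtain k where k: "x k \<noteq> y k" using assms by blast
  define l where "l = (LEAST k. x k \<noteq> y k)"
  have "x l \<noteq> y l" unfolding l_def using k by (rule LeastI)
  moreover have "x r = y r" if "r < l" for r
    using not_less_Least[of r "\<lambda>k. x k \<noteq> y k"] that by (auto simp: l_def)
  ultimately show ?thesis by (auto simp: less_fun_def neq_iff)
qed

lemma lex_le_iff_not_less_fun: "lex_le x y \<longleftrightarrow> \<not> less_fun y x"
  using less_fun_total less_fun_asym less_fun_irrefl by (auto simp: lex_le_def)

lemma lex_le_trans: "lex_le x y \<Longrightarrow> lex_le y z \<Longrightarrow> lex_le x z"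
  by (auto simp: lex_le_def intro: less_fun_trans)

lemma mem_M'_set_iff:
  "x \<in> M'_set m c d \<longleftrightarrow> x \<in> digit_seqs m \<and>
    (\<forall>n. \<not> less_fun (\<lambda>k. x (n + k)) c \<and> \<not> less_fun d (\<lambda>k. x (n + k)))"
  unfolding M'_set_def lex_le_iff_not_less_fun shift_power by blast

lemma M'_set_digit: "x \<in> M'_set m c d \<Longrightarrow> x k \<le> m"
  unfolding mem_M'_set_iff digit_seqs_def Pi_iff by simp

lemma M'_set_run_bounds:
  assumes "x \<in> M'_set m c d"
  shows "c (run c 0 x t) \<le> x t" "x t \<le> d (run d 0 x t)"
  using run_le_if_shifts_not_less[of x c] linorder.run_le_if_shifts_not_less[OF dual_linorder, of x d] assms
  unfolding seq_less_iff dual_seq_less_iff mem_M'_set_iff by auto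

text \<open>
  For \<open>c\<close> and \<open>d\<close> that are the least and the greatest element of \<open>M'_set m c d\<close>. This makes \<open>c\<close> the
  smallest and \<open>d\<close> the greatest of their own shifts, as the runs require.
\<close>
definition self_admissible :: "nat \<Rightarrow> (nat \<Rightarrow> nat) \<Rightarrow> (nat \<Rightarrow> nat) \<Rightarrow> bool"
  where "self_admissible m c d \<longleftrightarrow> c \<in> M'_set m c d \<and> d \<in> M'_set m c d"

lemma mem_M'_set_if_run_bounds:
  assumes adm: "self_admissible m c d" and "x \<in> digit_seqs m"
    and "\<And>t. c (run c i x t) \<le> x t" "\<And>t. x t \<le> d (run d j x t)"
  shows "x \<in> M'_set m c d"
proof -
  have "\<not> less_fun (\<lambda>k. x (n + k)) c" for n
    using shifts_not_less_if_run_le[where c = c and i = i and x = x and n = n] assms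
    unfolding seq_less_iff self_admissible_def mem_M'_set_iff by blast
  moreover have "\<not> less_fun d (\<lambda>k. x (n + k))" for n
    using linorder.shifts_not_less_if_run_le[OF dual_linorder, where c = d and i = j and x = x and n = n] assms
    unfolding dual_seq_less_iff self_admissible_def mem_M'_set_iff by blast
  ultimately show ?thesis using assms(2) by (simp add: mem_M'_set_iff)
qed

lemma M'_set_shift:
  assumes "x \<in> M'_set m c d"
  shows "(\<lambda>k. x (n + k)) \<in> M'_set m c d"
  using assms shift_digit_seqs unfolding mem_M'_set_iff add.assoc[symmetric] by blast

lemma M'_set_closed:
  assumes "\<And>n. \<exists>x\<in>M'_set m c d. \<forall>k<n. x k = z k"
  shows "z \<in> M'_set m c d"
proof -
  have "z k \<le> m" for k
  proof -
    obtain x where "x \<in> M'_set m c d" "\<forall>l<Suc k. x l = z l" using assms by blast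
    then show ?thesis using M'_set_digit[of x m c d k] by simp
  qed
  moreover have "\<not> less_fun (\<lambda>k. z (n + k)) c \<and> \<not> less_fun d (\<lambda>k. z (n + k))" for n
  proof (intro conjI notI)
    assume "less_fun (\<lambda>k. z (n + k)) c"
    then obtain k where k: "z (n + k) < c k" "\<forall>l<k. z (n + l) = c l" by (auto simp: less_fun_def)
    obtain x where x: "x \<in> M'_set m c d" "\<forall>l<Suc (n + k). x l = z l" using assms by blast
    then have "less_fun (\<lambda>k. x (n + k)) c"
      using k unfolding less_fun_def by (intro exI[of _ k]) auto
    then show False using x(1) unfolding mem_M'_set_iff by blast
  next
    assume "less_fun d (\<lambda>k. z (n + k))"
    then obtain k where k: "z (n + k) > d k" "\<forall>l<k. d l = z (n + l)" by (auto simp: less_fun_def)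
    obtain x where x: "x \<in> M'_set m c d" "\<forall>l<Suc (n + k). x l = z l" using assms by blast
    then have "less_fun d (\<lambda>k. x (n + k))"
      using k unfolding less_fun_def by (intro exI[of _ k]) auto
    then show False using x(1) unfolding mem_M'_set_iff by blast
  qed
  ultimately show ?thesis unfolding mem_M'_set_iff by (simp add: digit_seqs_def)
qed

text \<open>
  Replacing the bounds by the extreme elements of \<open>M'_set\<close> leaves \<open>M'_set\<close> alone, and it can only
  shrink \<open>M_set\<close>, which is harmless for a lower bound on the dimension of \<open>M_set\<close>.
\<close>
lemma ex_self_admissible_bounds:
  assumes "M'_set m c d \<noteq> {}"
  obtains c' d' where "self_admissible m c' d'" "lex_le c c'" "lex_le d' d"
    "M'_set m c' d' = M'_set m c d"
proof -
  have dig: "x k \<in> {0..m}" if "x \<in> M'_set m c d" for x k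
    using M'_set_digit[OF that] by simp
  obtain c' where c': "c' \<in> M'_set m c d" "\<And>x. x \<in> M'_set m c d \<Longrightarrow> \<not> less_fun x c'"
    using ex_seq_minimal[where F = "{0..m}", OF assms _ _ M'_set_closed[of m c d]] dig
    unfolding seq_less_iff by auto
  obtain d' where d': "d' \<in> M'_set m c d" "\<And>x. x \<in> M'_set m c d \<Longrightarrow> \<not> less_fun d' x"
    using linorder.ex_seq_minimal[where F = "{0..m}", OF dual_linorder assms _ _ M'_set_closed[of m c d]] dig
    unfolding dual_seq_less_iff by auto
  have le: "lex_le c c'" "lex_le d' d"
    using c'(1)[unfolded M'_set_def] d'(1)[unfolded M'_set_def]
    by (auto dest: spec[of _ 0])
  have eq: "M'_set m c' d' = M'_set m c d"
  proof
    show "M'_set m c' d' \<subseteq> M'_set m c d"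
      using le lex_le_trans unfolding M'_set_def by blast
    show "M'_set m c d \<subseteq> M'_set m c' d'"
    proof
      fix x assume x: "x \<in> M'_set m c d"
      then have "(\<lambda>k. x (n + k)) \<in> M'_set m c d" for n by (rule M'_set_shift)
      then show "x \<in> M'_set m c' d'"
        using x c'(2) d'(2) unfolding mem_M'_set_iff[of x] by blast
    qed
  qed
  show thesis
    using that[of c' d'] c'(1) d'(1) le eq by (simp add: self_admissible_def)
qed

lemma M_set_subset_M'_set: "M_set m c d \<subseteq> M'_set m c d"
proof
  fix x assume x: "x \<in> M_set m c d"
  have le_x: "lex_le ((shift ^^ n) x) x" for n
    using x by (cases n) (auto simp: M_set_def lex_le_def)
  have "lex_le c ((shift ^^ 1) x)" "lex_le x d"
    using x unfolding M_set_def by blast+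
  then have "lex_le c ((shift ^^ n) x)" for n
    using x le_x[of 1] by (cases n) (auto simp: M_set_def intro: lex_le_trans)
  then show "x \<in> M'_set m c d"
    using x le_x \<open>lex_le x d\<close> by (auto simp: M'_set_def M_set_def intro: lex_le_trans)
qed

lemma M_set_mono:
  assumes "lex_le c c'" "lex_le d' d"
  shows "M_set m c' d' \<subseteq> M_set m c d"
  using assms lex_le_trans unfolding M_set_def by blast

lemma mem_M_set_iff:
  "x \<in> M_set m c d \<longleftrightarrow> x \<in> M'_set m c d \<and> (\<forall>n\<ge>1. less_fun (\<lambda>k. x (n + k)) x)"
proof
  assume "x \<in> M_set m c d"
  then show "x \<in> M'_set m c d \<and> (\<forall>n\<ge>1. less_fun (\<lambda>k. x (n + k)) x)"
    using M_set_subset_M'_set by (auto simp: M_set_def shift_power)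
next
  assume x: "x \<in> M'_set m c d \<and> (\<forall>n\<ge>1. less_fun (\<lambda>k. x (n + k)) x)"
  then have "lex_le ((shift ^^ 0) x) d" unfolding M'_set_def by blast
  then show "x \<in> M_set m c d"
    using x by (auto simp: M_set_def M'_set_def shift_power)
qed

section \<open>Loops and the size of the larger set\<close>

text \<open>
  The words read along loops of length \<open>N\<close> at the state \<open>(i, j)\<close> of the pair of runs.
\<close>
definition loops :: "nat \<Rightarrow> (nat \<Rightarrow> nat) \<Rightarrow> (nat \<Rightarrow> nat) \<Rightarrow> nat \<Rightarrow> nat \<Rightarrow> nat \<Rightarrow> nat list set"
  where "loops m c d i j N = {take_seq N (\<lambda>r. x (t + r)) | x t. x \<in> M'_set m c d
    \<and> run c 0 x t = i \<and> run d 0 x t = j \<and> run c 0 x (t + N) = i \<and> run d 0 x (t + N) = j}"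

lemma loops_words: "w \<in> loops m c d i j N \<Longrightarrow> set w \<subseteq> {0..m} \<and> length w = N"
  using M'_set_digit by (fastforce simp: loops_def take_seq_def)

lemma finite_loops: "finite (loops m c d i j N)"
  by (rule finite_subset[OF _ finite_digit_words[of m N]]) (use loops_words in blast)

lemma run_nth_take_seq:
  "r \<le> N \<Longrightarrow> run c i (nth (take_seq N y)) r = run c i y r"
  by (rule run_cong) simp

lemma loops_run:
  assumes "w \<in> loops m c d i j N"
  shows "run c i (nth w) N = i" "run d j (nth w) N = j"
    and "r < N \<Longrightarrow> c (run c i (nth w) r) \<le> w ! r" "r < N \<Longrightarrow> w ! r \<le> d (run d j (nth w) r)"
proof -
  obtain x t where x: "x \<in> M'_set m c d" "w = take_seq N (\<lambda>r. x (t + r))"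
    "run c 0 x t = i" "run d 0 x t = j" "run c 0 x (t + N) = i" "run d 0 x (t + N) = j"
    using assms by (auto simp: loops_def)
  have *: "run e k (nth w) r = run e 0 x (t + r)" if "r \<le> N" "run e 0 x t = k" for e k r
    using that unfolding x(2) by (simp add: run_nth_take_seq run_add)
  show "run c i (nth w) N = i" "run d j (nth w) N = j" using x *[of N] by auto
  show "c (run c i (nth w) r) \<le> w ! r" "w ! r \<le> d (run d j (nth w) r)" if "r < N"
    using that x M'_set_run_bounds[OF x(1), of "t + r"] *[of r] by auto
qed

lemma run_blocks:
  assumes "0 < N" and "\<And>q. run c i (nth (bs q)) N = i" and "r \<le> N"
  shows "run c i (blocks N bs) (q * N + r) = run c i (nth (bs q)) r"
proof -
  have step: "run c (run c i (blocks N bs) (q * N)) (\<lambda>k. blocks N bs (q * N + k)) r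
      = run c (run c i (blocks N bs) (q * N)) (nth (bs q)) r" if "r \<le> N" for q r
    using that by (intro run_cong) (auto simp: blocks_def)
  have "run c i (blocks N bs) (q * N) = i" for q
  proof (induction q)
    case (Suc q)
    have "run c i (blocks N bs) (q * N + N) = i"
      unfolding run_add using step[of N q] Suc assms(2) by simp
    then show ?case by (simp add: add.commute)
  qed simp
  then show ?thesis unfolding run_add using step[OF assms(3)] by simp
qed

text \<open>
  Each loop returns to the state at which the next one may begin, so no digit ever violates the
  bounds imposed by the two runs.
\<close>
lemma loops_free:
  assumes adm: "self_admissible m c d" and "0 < N" and bs: "\<And>q. bs q \<in> loops m c d i j N"
  shows "blocks N bs \<in> M'_set m c d"
proof (rule mem_M'_set_if_run_bounds[OF adm])
  show "blocks N bs \<in> digit_seqs m"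
    using assms(2) loops_words[OF bs] by (rule blocks_in_digit_seqs)
  fix t
  have t: "t = t div N * N + t mod N" "t mod N < N" using assms(2) by auto
  have "run c i (blocks N bs) t = run c i (nth (bs (t div N))) (t mod N)"
    "run d j (blocks N bs) t = run d j (nth (bs (t div N))) (t mod N)"
    using run_blocks[where r = "t mod N" and q = "t div N" and bs = bs] loops_run(1,2)[OF bs] t assms(2)
    by (metis less_imp_le)+
  then show "c (run c i (blocks N bs) t) \<le> blocks N bs t" "blocks N bs t \<le> d (run d j (blocks N bs) t)"
    using loops_run(3,4)[OF bs t(2)] by (simp_all add: blocks_def)
qed

text \<open>
  A point that keeps returning to the state \<open>(i, j)\<close> has infinitely many prefixes that consist of its
  first \<open>t0\<close> digits and one loop. If there are at most \<open>(m + 1) ^ (N * t)\<close> loops of each length \<open>N\<close>,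
  the cylinders over these prefixes have a convergent sum of \<open>s\<close>-th powers of diameters.
\<close>
lemma recurrent_null:
  assumes m: "1 \<le> m" and "0 \<le> t" "t < s"
    and few: "\<And>N. 0 < N \<Longrightarrow> real (card (loops m c d i j N)) \<le> (real (m + 1) ^ N) powr t"
  shows "seq_hausdorff_measure m s {x \<in> M'_set m c d. run c 0 x t0 = i \<and> run d 0 x t0 = j \<and>
    (\<forall>n. \<exists>u\<ge>n. run c 0 x u = i \<and> run d 0 x u = j)} = 0"
    (is "seq_hausdorff_measure m s ?R = 0")
proof -
  define D where "D = {w. set w \<subseteq> {0..m} \<and> length w = t0}"
  define P where "P r = (if r = 0 then {} else (\<lambda>(u, w). u @ w) ` (D \<times> loops m c d i j r))" for r
  have "finite D" "card D = (m + 1) ^ t0"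
    unfolding D_def by (rule finite_digit_words, rule card_digit_words)
  show ?thesis
  proof (rule seq_hausdorff_null_if_covered[where P = P and \<tau> = "\<lambda>r. t0 + r", OF m])
    show "0 < s" using assms by simp
    show "?R \<subseteq> digit_seqs m" by (auto simp: mem_M'_set_iff)
    show "finite (P r)" for r using \<open>finite D\<close> finite_loops by (simp add: P_def)
    show "length w = t0 + r" if "w \<in> P r" for w r
      using that loops_words by (auto simp: P_def D_def split: if_splits)
    show "r \<le> t0 + r" for r by simp
    show "\<exists>r\<ge>n. take_seq (t0 + r) x \<in> P r" if x: "x \<in> ?R" for x n
    proof -
      obtain u where u: "t0 + Suc n \<le> u" "run c 0 x u = i" "run d 0 x u = j" using x by blast
      define r where "r = u - t0"
      have "take_seq t0 x \<in> D" using x take_seq_digits by (auto simp: D_def mem_M'_set_iff)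
      moreover have "take_seq r (\<lambda>k. x (t0 + k)) \<in> loops m c d i j r"
        using x u unfolding loops_def r_def by force
      moreover have "r \<noteq> 0" using u(1) by (simp add: r_def)
      ultimately have "take_seq (t0 + r) x \<in> P r"
        by (force simp: P_def take_seq_add)
      then show ?thesis using u(1) by (intro exI[of _ r]) (auto simp: r_def)
    qed
    define \<rho> where "\<rho> = real (m + 1) powr (t - s)"
    have "\<rho> < 1" unfolding \<rho>_def by (rule powr_less_one) (use m assms(3) in auto)
    show "summable (\<lambda>r. real (card (P r)) * (1 / real (m + 1) ^ (t0 + r)) powr s)"
    proof (rule summable_comparison_test')
      show "summable (\<lambda>r. real ((m + 1) ^ t0) * \<rho> ^ r)"
        using \<open>\<rho> < 1\<close> by (intro summable_mult summable_geometric) (simp add: \<rho>_def)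
      fix r
      have "card (P r) \<le> card (D \<times> loops m c d i j r)"
        using card_image_le[of "D \<times> loops m c d i j r" "\<lambda>(u, w). u @ w"] \<open>finite D\<close> finite_loops
        by (simp add: P_def)
      then have "real (card (P r)) \<le> real ((m + 1) ^ t0 * card (loops m c d i j r))"
        unfolding card_cartesian_product \<open>card D = _\<close> of_nat_le_iff .
      then have "real (card (P r)) \<le> real ((m + 1) ^ t0) * real (card (loops m c d i j r))"
        unfolding of_nat_mult .
      moreover have "real (card (P r)) \<le> real ((m + 1) ^ t0) * (real (m + 1) ^ r) powr t"
      proof (cases "r = 0")
        case False
        then show ?thesis using few[of r] calculation
          by (meson mult_left_mono of_nat_0_le_iff order_trans gr0I)
      qed (simp add: P_def)
      moreover have "(1 / real (m + 1) ^ (t0 + r)) powr s \<le> (1 / real (m + 1) ^ r) powr s"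
        using assms by (intro powr_mono2 divide_left_mono power_increasing) auto
      ultimately have "real (card (P r)) * (1 / real (m + 1) ^ (t0 + r)) powr s
          \<le> (real ((m + 1) ^ t0) * (real (m + 1) ^ r) powr t) * (1 / real (m + 1) ^ r) powr s"
        by (intro mult_mono) auto
      also have "\<dots> = real ((m + 1) ^ t0) * \<rho> ^ r"
      proof -
        have "(real (m + 1) ^ r) powr t * (1 / real (m + 1) ^ r) powr s = (real (m + 1) ^ r) powr (t - s)"
          by (simp add: powr_divide powr_diff)
        also have "\<dots> = \<rho> ^ r"
          by (simp add: \<rho>_def power_powr_swap)
        finally show ?thesis by simp
      qed
      finally show "norm (real (card (P r)) * (1 / real (m + 1) ^ (t0 + r)) powr s)
          \<le> real ((m + 1) ^ t0) * \<rho> ^ r" by simp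
    qed
  qed
qed

definition escaping :: "nat \<Rightarrow> (nat \<Rightarrow> nat) \<Rightarrow> (nat \<Rightarrow> nat) \<Rightarrow> nat \<Rightarrow> nat \<Rightarrow> (nat \<Rightarrow> nat) set"
  where "escaping m c d n k =
    {x \<in> digit_seqs m. \<forall>t\<ge>k. n \<le> max (run c 0 x t) (run d 0 x t)}"

text \<open>
  A mismatch with \<open>c\<close> resets the run of \<open>c\<close> to \<open>0\<close>, and it needs \<open>n\<close> further steps to reach \<open>n\<close>
  again; throughout this time the run of \<open>d\<close> must be at least \<open>n\<close> and so cannot be reset. By
  symmetry, a window of length \<open>n\<close> contains mismatches with at most one of \<open>c\<close> and \<open>d\<close>, and then it
  copies the other one.
\<close>
lemma escaping_window:
  assumes x: "x \<in> escaping m c d n k" and "k \<le> t"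
  shows "take_seq n (\<lambda>r. x (t + r)) = take_seq n (\<lambda>r. c (run c 0 x t + r)) \<or>
    take_seq n (\<lambda>r. x (t + r)) = take_seq n (\<lambda>r. d (run d 0 x t + r))"
proof (rule ccontr)
  assume contra: "\<not> ?thesis"
  have ex_reset: "\<exists>r<n. run e 0 x (Suc (t + r)) = 0"
    if "take_seq n (\<lambda>r. x (t + r)) \<noteq> take_seq n (\<lambda>r. e (run e 0 x t + r))" for e
    using run_follow[of n x t e 0] that by force
  have small: "run e 0 x (Suc (t + r')) < n" if "run e 0 x (Suc (t + r)) = 0" "r \<le> r'" "r' < n" for e r r'
  proof -
    have "run e 0 x (Suc (t + r) + (r' - r)) \<le> r' - r"
      unfolding run_add[of e 0 x "Suc (t + r)"] that(1) by (rule order_trans[OF run_le]) simp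
    then show ?thesis using that by simp
  qed
  obtain r r' where r: "r < n" "run c 0 x (Suc (t + r)) = 0" "r' < n" "run d 0 x (Suc (t + r')) = 0"
    using contra ex_reset by blast
  have big: "n \<le> max (run c 0 x (Suc (t + u))) (run d 0 x (Suc (t + u)))" for u
  proof -
    have "k \<le> Suc (t + u)" using assms(2) by simp
    then show ?thesis using x unfolding escaping_def by blast
  qed
  show False
  proof (cases "r \<le> r'")
    case True
    then have "run c 0 x (Suc (t + r')) < n" using small[OF r(2) _ r(3)] by simp
    then show False using big[of r'] r(3,4) by linarith
  next
    case False
    then have "run d 0 x (Suc (t + r)) < n" using small[OF r(4) _ r(1)] by simp
    then show False using big[of r] r(1,2) by linarith
  qed
qed

text \<open>
  Each window of length \<open>n\<close> offers two continuations, where \<open>(m + 1) ^ (n * s)\<close> would be needed for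
  positive measure.
\<close>
lemma escaping_null:
  assumes m: "1 \<le> m" and "0 < s" and n: "0 < n" "2 < (real (m + 1) ^ n) powr s"
  shows "seq_hausdorff_measure m s (escaping m c d n k) = 0"
proof -
  define P where "P r = take_seq (k + r * n) ` escaping m c d n k" for r
  have P_words: "P r \<subseteq> {w. set w \<subseteq> {0..m} \<and> length w = k + r * n}" for r
    using take_seq_digits by (auto simp: P_def escaping_def)
  have fin: "finite (P r)" for r
    by (rule finite_subset[OF P_words finite_digit_words])
  have card_P: "card (P r) \<le> (m + 1) ^ k * 2 ^ r" for r
  proof (induction r)
    case 0
    have "card (P 0) \<le> card {w. set w \<subseteq> {0..m} \<and> length w = k}"
      using P_words[of 0] by (intro card_mono finite_digit_words) auto
    then show ?case by (simp add: card_digit_words)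
  next
    case (Suc r)
    let ?ext = "\<lambda>e w. w @ take_seq n (\<lambda>r. e (run e 0 (nth w) (length w) + r))"
    have "P (Suc r) \<subseteq> ?ext c ` P r \<union> ?ext d ` P r"
    proof
      fix w assume "w \<in> P (Suc r)"
      then obtain x where x: "x \<in> escaping m c d n k" "w = take_seq (k + Suc r * n) x"
        by (auto simp: P_def)
      let ?t = "k + r * n"
      have w: "w = take_seq ?t x @ take_seq n (\<lambda>r. x (?t + r))"
        unfolding x(2) take_seq_add[symmetric] by (simp add: ac_simps)
      have "take_seq ?t x \<in> P r" using x(1) by (auto simp: P_def)
      moreover have "w = ?ext c (take_seq ?t x) \<or> w = ?ext d (take_seq ?t x)"
        using escaping_window[OF x(1), of ?t] unfolding w by (auto simp: run_nth_take_seq)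
      ultimately show "w \<in> ?ext c ` P r \<union> ?ext d ` P r" by blast
    qed
    then have "card (P (Suc r)) \<le> card (?ext c ` P r \<union> ?ext d ` P r)"
      using fin by (intro card_mono) auto
    also have "\<dots> \<le> card (P r) + card (P r)"
      by (rule order_trans[OF card_Un_le add_mono]) (intro card_image_le fin)+
    finally show ?case using Suc by simp
  qed
  define R where "R = (real (m + 1) ^ n) powr s"
  show ?thesis
  proof (rule seq_hausdorff_null_if_covered[where P = P and \<tau> = "\<lambda>r. k + r * n", OF m \<open>0 < s\<close>])
    show "escaping m c d n k \<subseteq> digit_seqs m" by (auto simp: escaping_def)
    show "finite (P r)" for r by (rule fin)
    show "length w = k + r * n" if "w \<in> P r" for w r using that P_words by blast
    show "r \<le> k + r * n" for r using n(1) by (simp add: trans_le_add2)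
    show "\<exists>r\<ge>n'. take_seq (k + r * n) x \<in> P r" if "x \<in> escaping m c d n k" for x n'
      using that by (auto simp: P_def)
    show "summable (\<lambda>r. real (card (P r)) * (1 / real (m + 1) ^ (k + r * n)) powr s)"
    proof (rule summable_comparison_test')
      show "summable (\<lambda>r. real ((m + 1) ^ k) * (2 / R) ^ r)"
        using n(2) by (intro summable_mult summable_geometric) (simp add: R_def)
      fix r
      have "real (card (P r)) \<le> real ((m + 1) ^ k * 2 ^ r)"
        using card_P by (simp only: of_nat_le_iff)
      moreover have "(1 / real (m + 1) ^ (k + r * n)) powr s \<le> (1 / real (m + 1) ^ (r * n)) powr s"
        using \<open>0 < s\<close> by (intro powr_mono2 divide_left_mono power_increasing) auto
      moreover have "(1 / real (m + 1) ^ (r * n)) powr s = 1 / R ^ r"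
        by (simp add: R_def powr_divide powr_power powr_powr mult_ac flip: powr_realpow)
      ultimately have "real (card (P r)) * (1 / real (m + 1) ^ (k + r * n)) powr s
          \<le> real ((m + 1) ^ k * 2 ^ r) * (1 / R ^ r)"
        by (intro mult_mono) auto
      then show "norm (real (card (P r)) * (1 / real (m + 1) ^ (k + r * n)) powr s)
          \<le> real ((m + 1) ^ k) * (2 / R) ^ r"
        by (simp add: power_divide)
    qed
  qed
qed

text \<open>
  If both run lengths are below \<open>n\<close> infinitely often, one of these finitely many states recurs.
\<close>
lemma M'_set_escaping_or_recurrent:
  assumes "x \<in> M'_set m c d"
  shows "(\<exists>k. x \<in> escaping m c d n k) \<or>
    (\<exists>i j t0. run c 0 x t0 = i \<and> run d 0 x t0 = j \<and> (\<forall>n. \<exists>u\<ge>n. run c 0 x u = i \<and> run d 0 x u = j))"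
proof (cases "\<exists>k. \<forall>t\<ge>k. n \<le> max (run c 0 x t) (run d 0 x t)")
  case True
  then show ?thesis using assms by (auto simp: escaping_def mem_M'_set_iff)
next
  case False
  define T where "T = {t. run c 0 x t < n \<and> run d 0 x t < n}"
  have "infinite T"
    using False unfolding T_def infinite_nat_iff_unbounded_le by (auto simp: not_le)
  moreover have "finite ((\<lambda>t. (run c 0 x t, run d 0 x t)) ` T)"
    by (rule finite_subset[of _ "{..<n} \<times> {..<n}"]) (auto simp: T_def)
  ultimately obtain t0 where "t0 \<in> T"
      "infinite {u \<in> T. (run c 0 x u, run d 0 x u) = (run c 0 x t0, run d 0 x t0)}"
    using pigeonhole_infinite by blast
  then have "\<forall>n. \<exists>u\<ge>n. run c 0 x u = run c 0 x t0 \<and> run d 0 x u = run d 0 x t0"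
    unfolding infinite_nat_iff_unbounded_le by auto
  then show ?thesis by blast
qed

lemma M'_set_null_if_few_loops:
  assumes m: "1 \<le> m" and "0 \<le> t" "t < s"
    and few: "\<And>i j N. 0 < N \<Longrightarrow> real (card (loops m c d i j N)) \<le> (real (m + 1) ^ N) powr t"
  shows "seq_hausdorff_measure m s (M'_set m c d) = 0"
proof -
  interpret Metric_space "digit_seqs m" "seq_dist m" by (rule Metric_space_seq_dist)
  define q where "q = real (m + 1) powr s"
  have "1 < q" using assms by (simp add: q_def)
  then obtain n0 where "2 < q ^ n0" using real_arch_pow by blast
  define n where "n = Suc n0"
  have "q ^ n0 \<le> q ^ n" using \<open>1 < q\<close> by (simp add: n_def)
  then have "2 < q ^ n" using \<open>2 < q ^ n0\<close> by simp
  also have "q ^ n = (real (m + 1) ^ n) powr s"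
    by (simp add: q_def power_powr_swap)
  finally have n: "0 < n" "2 < (real (m + 1) ^ n) powr s" by (simp_all add: n_def)
  define R where "R = (\<lambda>(i, j, t0). {x \<in> M'_set m c d. run c 0 x t0 = i \<and> run d 0 x t0 = j \<and>
    (\<forall>n. \<exists>u\<ge>n. run c 0 x u = i \<and> run d 0 x u = j)})"
  have esc: "hausdorff_measure s (\<Union>k. escaping m c d n k) = 0"
    using escaping_null[OF m _ n] assms by (intro hausdorff_measure_UN_null) auto
  have rec: "hausdorff_measure s (\<Union>p. R p) = 0"
    using recurrent_null[OF m assms(2,3) few] by (intro hausdorff_measure_UN_null) (auto simp: R_def)
  let ?B = "\<lambda>b. if b then (\<Union>k. escaping m c d n k) else (\<Union>p. R p)"
  have "M'_set m c d \<subseteq> (\<Union>b. ?B b)"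
  proof
    fix x assume x: "x \<in> M'_set m c d"
    consider k where "x \<in> escaping m c d n k" | i j t0 where "x \<in> R (i, j, t0)"
      using M'_set_escaping_or_recurrent[OF x, of n] x unfolding R_def by blast
    then show "x \<in> (\<Union>b. ?B b)"
    proof cases
      case 1
      then have "x \<in> ?B True" by auto
      then show ?thesis by blast
    next
      case 2
      then have "x \<in> ?B False" by auto
      then show ?thesis by blast
    qed
  qed
  then have "hausdorff_measure s (M'_set m c d) \<le> hausdorff_measure s (\<Union>b. ?B b)"
    by (rule hausdorff_measure_mono)
  also have "\<dots> = 0"
    using esc rec by (intro hausdorff_measure_UN_null) auto
  finally show ?thesis by simp
qed

section \<open>Lyndon words among concatenations of blocks\<close>

lemma list_less_append_if_less:
  fixes xs ys :: "'a::order list"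
  shows "length xs = length ys \<Longrightarrow> xs < ys \<Longrightarrow> xs @ us < ys @ vs"
  unfolding list_less_def by (rule lexord_sufI) auto

lemma list_append_less_iff:
  fixes xs :: "'a::order list"
  shows "xs @ us < xs @ vs \<longleftrightarrow> us < vs"
  unfolding list_less_def by (rule lexord_same_pref_if_irrefl) (simp add: irrefl_def)

lemma take_mono_if_length_eq:
  fixes xs ys :: "'a::linorder list"
  assumes "xs \<le> ys" "length xs = length ys"
  shows "take n xs \<le> take n ys"
proof (rule ccontr)
  assume "\<not> ?thesis"
  then have "take n ys < take n xs" by simp
  then have "take n ys @ drop n ys < take n xs @ drop n xs"
    using assms(2) by (intro list_less_append_if_less) auto
  then show False using assms(1) by simp
qed

lemma less_fun_if_take_seq_less:
  assumes "take_seq n x < take_seq n y"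
  shows "less_fun x y"
proof -
  obtain i where i: "i < n" "take i (take_seq n x) = take i (take_seq n y)"
    "take_seq n x ! i < take_seq n y ! i"
    using assms unfolding list_less_def lexord_take_index_conv by auto
  have "x k = y k" if "k < i" for k
    using arg_cong[OF i(2), of "\<lambda>w. w ! k"] that i(1) by simp
  then show ?thesis using i(1,3) by (auto simp: less_fun_def)
qed

text \<open>
  Lyndon words for the reversed order of the letters. As \<open>drop r l\<close> and \<open>take (length l - r) l\<close> have
  the same length, a proper suffix is required to lose against the prefix of equal length already,
  so the comparison remains strict whatever is appended to the suffix. In particular a Lyndon word
  has no border.
\<close>
definition lyndon :: "'a::linorder list \<Rightarrow> bool"
  where "lyndon l \<longleftrightarrow> (\<forall>r. 0 < r \<and> r < length l \<longrightarrow> drop r l < take (length l - r) l)"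

definition primitive :: "'a list \<Rightarrow> bool"
  where "primitive w \<longleftrightarrow> (\<forall>r. 0 < r \<and> r < length w \<longrightarrow> rotate r w \<noteq> w)"

text \<open>
  If a suffix equals the prefix of the same length, write \<open>l = v @ a = e @ v\<close>. The rotation \<open>v @ e\<close> is
  smaller than \<open>l\<close>, so \<open>e < a\<close>, and then the rotation \<open>a @ v\<close> is greater than \<open>l\<close>.
\<close>
lemma lyndon_if_rotations_less:
  assumes less: "\<And>r. 0 < r \<Longrightarrow> r < length l \<Longrightarrow> rotate r l < l"
  shows "lyndon l"
  unfolding lyndon_def
proof (intro allI impI, rule ccontr)
  fix r
  let ?s = "length l - r"
  assume r: "0 < r \<and> r < length l" and not_less: "\<not> drop r l < take ?s l"
  have split: "l = take ?s l @ drop ?s l" "l = take r l @ drop r l" by simp_all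
  have rot: "rotate r l = drop r l @ take r l" "rotate ?s l = drop ?s l @ take ?s l"
    unfolding rotate_drop_take using r mod_less[of r "length l"] mod_less[of ?s "length l"] by auto
  have border: "drop r l = take ?s l"
  proof (rule ccontr)
    assume "drop r l \<noteq> take ?s l"
    then have "take ?s l < drop r l" using not_less by simp
    then have "take ?s l @ drop ?s l < drop r l @ take r l"
      by (intro list_less_append_if_less) simp_all
    then show False using less[of r] r rot(1) by (simp add: order_less_not_sym)
  qed
  have "take ?s l @ take r l < take ?s l @ drop ?s l"
    using less[of r] r rot(1) border by simp
  then have "take r l < drop ?s l" unfolding list_append_less_iff .
  then have "take r l @ drop r l < drop ?s l @ take ?s l"
    using r by (intro list_less_append_if_less) simp_all
  then have "l < rotate ?s l" unfolding rot(2) by simp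
  moreover have "rotate ?s l < l" using r by (intro less) linarith+
  ultimately show False by simp
qed

lemma primitive_has_lyndon_rotation:
  fixes w :: "'a::linorder list"
  assumes "primitive w" "w \<noteq> []"
  shows "\<exists>r<length w. lyndon (rotate r w)"
proof -
  let ?L = "length w"
  define A where "A = (\<lambda>r. rotate r w) ` {..<?L}"
  have "finite A" "A \<noteq> {}" using assms(2) by (auto simp: A_def)
  then have "Max A \<in> A" by (rule Max_in)
  then obtain r0 where r0: "r0 < ?L" "Max A = rotate r0 w" by (auto simp: A_def)
  have "rotate r (rotate r0 w) < rotate r0 w" if "0 < r" "r < ?L" for r
  proof -
    have "rotate r (rotate r0 w) = rotate ((r + r0) mod ?L) w"
      by (simp add: rotate_rotate flip: rotate_conv_mod)
    then have "rotate r (rotate r0 w) \<in> A" using assms(2) by (simp add: A_def)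
    then have "rotate r (rotate r0 w) \<le> rotate r0 w"
      using \<open>finite A\<close> r0(2) by (metis Max_ge)
    moreover have "rotate r (rotate r0 w) \<noteq> rotate r0 w"
    proof
      assume eq: "rotate r (rotate r0 w) = rotate r0 w"
      have "rotate r (rotate (?L - r0 + r0) w) = rotate (?L - r0) (rotate r (rotate r0 w))"
        by (simp add: rotate_rotate ac_simps)
      also have "\<dots> = rotate (?L - r0 + r0) w" unfolding eq by (simp add: rotate_rotate)
      finally have "rotate r w = w" using r0(1) by simp
      then show False using assms(1) that by (auto simp: primitive_def)
    qed
    ultimately show ?thesis by simp
  qed
  then have "lyndon (rotate r0 w)" by (intro lyndon_if_rotations_less) simp_all
  then show ?thesis using r0(1) by blast
qed

text \<open>
  A word fixed by a rotation by \<open>r\<close> has period \<open>r\<close>, so its first \<open>r\<close> letters determine it.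
\<close>
lemma eq_if_same_rotation_period:
  assumes w: "rotate r w = w" and w': "rotate r w' = w'" and len: "length w = length w'"
    and r: "0 < r" "r \<le> n" "r < length w" and take: "take n w = take n w'"
  shows "w = w'"
proof (rule nth_equalityI)
  have per: "v ! p = v ! (p - r)" if "rotate r v = v" "length v = length w" "r \<le> p" "p < length w" for v p
    using nth_rotate[of "p - r" v r] that r by simp
  show "w ! p = w' ! p" if "p < length w" for p
    using that
  proof (induction p rule: less_induct)
    case (less p)
    show ?case
    proof (cases "p < r")
      case True
      then have "take n w ! p = w ! p" "take n w' ! p = w' ! p" using r by simp_all
      then show ?thesis using take by simp
    next
      case False
      then have "w ! p = w ! (p - r)" "w' ! p = w' ! (p - r)"
        using per[of w p] per[of w' p] w w' len less.prems by simp_all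
      then show ?thesis using less.IH[of "p - r"] less.prems False r(1) by simp
    qed
  qed
qed (rule len)

definition block_lists :: "'a list set \<Rightarrow> nat \<Rightarrow> 'a list list set"
  where "block_lists B k = {us. set us \<subseteq> B \<and> length us = k}"

lemma finite_block_lists: "finite B \<Longrightarrow> finite (block_lists B k)"
  unfolding block_lists_def by (rule finite_lists_length_eq)

lemma card_block_lists: "finite B \<Longrightarrow> card (block_lists B k) = card B ^ k"
  unfolding block_lists_def by (rule card_lists_length_eq)

lemma inj_on_concat_block_lists:
  assumes "\<And>b. b \<in> B \<Longrightarrow> length b = N"
  shows "inj_on concat (block_lists B k)"
proof (rule inj_onI, rule concat_injective)
  fix us us' assume us: "us \<in> block_lists B k" "us' \<in> block_lists B k"
  then show "length us = length us'" by (simp add: block_lists_def)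
  show "\<forall>(x, y)\<in>set (zip us us'). length x = length y"
  proof clarify
    fix x y assume xy: "(x, y) \<in> set (zip us us')"
    have "x \<in> B" "y \<in> B"
      using set_zip_leftD[OF xy] set_zip_rightD[OF xy] us by (auto simp: block_lists_def)
    then show "length x = length y" using assms by simp
  qed
qed

lemma length_concat_blocks:
  assumes "\<And>b. b \<in> set us \<Longrightarrow> length b = N"
  shows "length (concat us) = length us * N"
  using assms by (induction us) auto

lemma nth_concat_blocks:
  assumes "\<And>b. b \<in> set us \<Longrightarrow> length b = N" "p < length us * N"
  shows "concat us ! p = us ! (p div N) ! (p mod N)"
  using assms
proof (induction us arbitrary: p)
  case (Cons b us)
  have "0 < N" using Cons.prems(2) by (cases N) auto
  show ?case
  proof (cases "p < N")
    case False
    then have "p div N = Suc ((p - N) div N)" "p mod N = (p - N) mod N"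
      using \<open>0 < N\<close> by (simp_all add: le_div_geq le_mod_geq)
    then show ?thesis using False Cons by (simp add: nth_append)
  qed (use Cons in \<open>simp add: nth_append\<close>)
qed simp

lemma rotate_concat_blocks:
  assumes "\<And>b. b \<in> set us \<Longrightarrow> length b = N"
  shows "rotate (e * N) (concat us) = concat (rotate e us)"
proof (induction e)
  case (Suc e)
  have "rotate (Suc e * N) (concat us) = rotate N (concat (rotate e us))"
    using Suc by (simp flip: rotate_rotate)
  also have "\<dots> = concat (rotate (Suc e) us)"
  proof (cases "rotate e us")
    case (Cons b vs)
    then have "b \<in> set us" by (metis list.set_intros(1) set_rotate)
    then show ?thesis using assms Cons rotate_append[of b "concat vs"] by simp
  qed simp
  finally show ?case .
qed simp

lemma blocks_concat:
  assumes "0 < N" "0 < K" "\<And>q. us q \<in> block_lists B K" "\<And>b. b \<in> B \<Longrightarrow> length b = N"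
  shows "blocks N (\<lambda>n. us (n div K) ! (n mod K)) = blocks (N * K) (\<lambda>q. concat (us q))"
proof
  fix p
  let ?q = "p div (N * K)" and ?r = "p mod (N * K)"
  have "?r < length (us ?q) * N"
    using assms by (simp add: block_lists_def mult.commute)
  then have "concat (us ?q) ! ?r = us ?q ! (?r div N) ! (?r mod N)"
    using assms(3,4) by (intro nth_concat_blocks) (auto simp: block_lists_def)
  moreover have "?r div N = p div N mod K" "?r mod N = p mod N"
    using assms(1) by (simp_all add: mod_mult2_eq)
  ultimately show "blocks N (\<lambda>n. us (n div K) ! (n mod K)) p = blocks (N * K) (\<lambda>q. concat (us q)) p"
    by (simp add: blocks_def div_mult2_eq)
qed

text \<open>
  Moving the first \<open>\<rho>\<close> letters of every block to its end shifts the whole concatenation, provided that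
  the letters moved are the same in all blocks: what one block loses is supplied by its predecessor.
\<close>
lemma blocks_rotate_common_prefix:
  assumes "\<rho> < length b" "\<And>q. length (b @ v q) = L"
  shows "blocks L (\<lambda>q. b @ v q) (\<rho> + p) = blocks L (\<lambda>q. drop \<rho> b @ v q @ take \<rho> b) p"
proof -
  let ?q = "p div L" and ?r = "p mod L"
  have "0 < L" using assms(1) assms(2)[of 0] by auto
  then have "?r < L" by simp
  have p: "\<rho> + p = ?q * L + (\<rho> + ?r)" by simp
  have "\<rho> < L" using assms(1) assms(2)[of 0] by auto
  show ?thesis
  proof (cases "\<rho> + ?r < L")
    case True
    have "(\<rho> + p) div L = ?q" "(\<rho> + p) mod L = \<rho> + ?r"
      using div_mult_self3[of L ?q "\<rho> + ?r"] mod_mult_self3[of ?q L "\<rho> + ?r"] True \<open>0 < L\<close> p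
      by (metis add_0_right div_less less_not_refl, metis mod_less)
    moreover have "(drop \<rho> b @ v ?q @ take \<rho> b) ! ?r = (b @ v ?q) ! (\<rho> + ?r)"
      using True assms(1) assms(2)[of ?q] by (auto simp: nth_append add.commute)
    ultimately show ?thesis by (simp add: blocks_def)
  next
    case False
    define j where "j = \<rho> + ?r - L"
    have j: "\<rho> + ?r = L + j" "j < \<rho>"
      using False \<open>?r < L\<close> by (simp_all add: j_def)
    have "\<rho> + p = Suc ?q * L + j" using p j(1) by simp
    moreover have "j < L" using j(2) \<open>\<rho> < L\<close> by simp
    ultimately have "(\<rho> + p) div L = Suc ?q" "(\<rho> + p) mod L = j"
      using div_mult_self3[of L "Suc ?q" j] mod_mult_self3[of "Suc ?q" L j] \<open>0 < L\<close>
      by (metis add_0_right div_less less_not_refl, metis mod_less)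
    moreover have "(drop \<rho> b @ v ?q @ take \<rho> b) ! ?r = b ! j"
    proof -
      have "?r + \<rho> - L = j" using j(1) by simp
      then show ?thesis using j assms(1) assms(2)[of ?q] by (auto simp: nth_append)
    qed
    ultimately show ?thesis
      using j(2) assms(1) by (simp add: blocks_def nth_append)
  qed
qed

text \<open>
  Lyndon words that arise from a concatenation of the block \<open>b\<close> and \<open>k\<close> blocks of \<open>B\<close> by moving the
  first \<open>\<rho>\<close> letters of \<open>b\<close> to the end. Fixing \<open>\<rho>\<close> and \<open>b\<close> makes these words freely concatenable: up
  to a shift by \<open>\<rho>\<close>, any concatenation of them is one of blocks of \<open>B\<close>.
\<close>
definition lyndon_block_words :: "'a::linorder list set \<Rightarrow> nat \<Rightarrow> nat \<Rightarrow> 'a list \<Rightarrow> 'a list set"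
  where "lyndon_block_words B k \<rho> b =
    {l. lyndon l \<and> (\<exists>us\<in>block_lists B k. l = drop \<rho> b @ concat us @ take \<rho> b)}"

lemma finite_lyndon_block_words: "finite B \<Longrightarrow> finite (lyndon_block_words B k \<rho> b)"
  by (rule finite_subset[of _ "(\<lambda>us. drop \<rho> b @ concat us @ take \<rho> b) ` block_lists B k"])
    (auto simp: lyndon_block_words_def finite_block_lists)

lemma length_lyndon_block_words:
  assumes "l \<in> lyndon_block_words B k \<rho> b" "b \<in> B" "\<And>b. b \<in> B \<Longrightarrow> length b = N" "\<rho> < N"
  shows "length l = N * Suc k"
proof -
  obtain us where us: "us \<in> block_lists B k" "l = drop \<rho> b @ concat us @ take \<rho> b"
    using assms(1) by (auto simp: lyndon_block_words_def)
  have "length (concat us) = k * N"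
    using length_concat_blocks[of us N] us(1) assms(3) by (auto simp: block_lists_def)
  then show ?thesis using us(2) assms(2-4) by (auto simp: min_def)
qed

text \<open>
  The rotation that makes the word Lyndon is by \<open>\<rho>\<close> letters more than a whole number of blocks.
  Rotating by these blocks first brings the block \<open>b\<close> to the front, which the remaining \<open>\<rho>\<close> letters
  cut.
\<close>
lemma primitive_is_rotated_lyndon_block_word:
  assumes "us \<in> block_lists B (Suc k)" "\<And>b. b \<in> B \<Longrightarrow> length b = N" "0 < N"
    and "primitive (concat us)"
  shows "concat us \<in> (\<Union>r\<in>{..Suc k * N}. \<Union>\<rho>\<in>{..<N}. \<Union>b\<in>B. rotate r ` lyndon_block_words B k \<rho> b)"
proof -
  let ?w = "concat us" and ?L = "Suc k * N"
  have len_us: "\<And>b. b \<in> set us \<Longrightarrow> length b = N" "length us = Suc k"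
    using assms(1,2) by (auto simp: block_lists_def)
  have len: "length ?w = ?L" using length_concat_blocks[OF len_us(1)] len_us(2) by simp
  then have "?w \<noteq> []" using assms(3) by (metis length_0_conv mult_is_0 nat.distinct(1) neq0_conv)
  then obtain r0 where r0: "r0 < ?L" "lyndon (rotate r0 ?w)"
    using primitive_has_lyndon_rotation[OF assms(4)] len by auto
  define e \<rho> where "e = r0 div N" and "\<rho> = r0 mod N"
  have \<rho>: "\<rho> < N" "r0 = \<rho> + e * N" using assms(3) by (simp_all add: \<rho>_def e_def)
  obtain b vs where bvs: "rotate e us = b # vs"
    using len_us(2) by (metis length_0_conv length_rotate list.exhaust nat.distinct(1))
  have "set (rotate e us) \<subseteq> B" "length (rotate e us) = Suc k"
    using assms(1) by (auto simp: block_lists_def)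
  then have "b \<in> B" "vs \<in> block_lists B k" by (auto simp: bvs block_lists_def)
  have "length b = N" using \<open>b \<in> B\<close> assms(2) by simp
  have "rotate r0 ?w = rotate \<rho> (b @ concat vs)"
  proof -
    have "rotate (e * N) ?w = concat (rotate e us)"
      by (rule rotate_concat_blocks[OF len_us(1)])
    then show ?thesis unfolding \<rho>(2) rotate_rotate[symmetric] bvs by simp
  qed
  also have "\<dots> = drop \<rho> b @ concat vs @ take \<rho> b"
    using \<rho>(1) \<open>length b = N\<close> by (simp add: rotate_drop_take)
  finally have "rotate r0 ?w \<in> lyndon_block_words B k \<rho> b"
    using r0(2) \<open>vs \<in> block_lists B k\<close> by (auto simp: lyndon_block_words_def)
  moreover have "?w = rotate (?L - r0) (rotate r0 ?w)"
    using r0(1) len by (simp add: rotate_rotate)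
  moreover have "?L - r0 \<in> {..?L}" by simp
  ultimately show ?thesis using \<rho>(1) \<open>b \<in> B\<close> by blast
qed

text \<open>
  If a word is fixed by the rotation by \<open>r\<close>, it is also fixed by that by its length minus \<open>r\<close>, so it
  has a period of at most half its length and is determined by its first \<open>n\<close> blocks.
\<close>
lemma card_nonprimitive_le:
  assumes B: "finite B" "\<And>b. b \<in> B \<Longrightarrow> length b = N"
  shows "card {us \<in> block_lists B (2 * n). \<not> primitive (concat us)} \<le> n * N * card B ^ n"
proof -
  let ?L = "2 * n * N"
  define P where "P r = {us \<in> block_lists B (2 * n). rotate r (concat us) = concat us}" for r
  have fin: "finite (P r)" for r using finite_block_lists[OF B(1)] by (simp add: P_def)
  have len: "length (concat us) = k * N" if "us \<in> block_lists B k" for us k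
    using length_concat_blocks[of us N] that B(2) by (auto simp: block_lists_def)
  have card_P: "card (P r) \<le> card B ^ n" if r: "0 < r" "r \<le> n * N" for r
  proof -
    have "inj_on (take n) (P r)"
    proof (rule inj_onI)
      fix us us' assume us: "us \<in> P r" "us' \<in> P r" and eq: "take n us = take n us'"
      have take_concat: "take (n * N) (concat vs) = concat (take n vs)" if "vs \<in> P r" for vs
      proof -
        have "take n vs \<in> block_lists B n"
          using that by (auto simp: P_def block_lists_def dest: in_set_takeD)
        moreover have "concat vs = concat (take n vs) @ concat (drop n vs)"
          by (metis append_take_drop_id concat_append)
        ultimately show ?thesis using len[of "take n vs" n] by simp
      qed
      have "concat us = concat us'"
      proof (rule eq_if_same_rotation_period[where n = "n * N" and r = r])
        show "length (concat us) = length (concat us')" "r < length (concat us)"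
          using us len[of _ "2 * n"] r by (auto simp: P_def)
      qed (use us r eq take_concat in \<open>auto simp: P_def\<close>)
      then show "us = us'"
        using inj_onD[OF inj_on_concat_block_lists[OF B(2)]] us by (auto simp: P_def)
    qed
    moreover have "take n ` P r \<subseteq> block_lists B n"
      by (auto simp: P_def block_lists_def dest: in_set_takeD)
    ultimately have "card (P r) \<le> card (block_lists B n)"
      by (metis card_image card_mono finite_block_lists B(1))
    then show ?thesis by (simp add: card_block_lists B(1))
  qed
  have "{us \<in> block_lists B (2 * n). \<not> primitive (concat us)} \<subseteq> (\<Union>r\<in>{1..n * N}. P r)"
  proof
    fix us assume us: "us \<in> {us \<in> block_lists B (2 * n). \<not> primitive (concat us)}"
    let ?w = "concat us"
    have L: "length ?w = ?L" using us len by simp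
    obtain r where r: "0 < r" "r < ?L" "rotate r ?w = ?w"
      using us L by (auto simp: primitive_def)
    have "rotate (?L - r) ?w = rotate (?L - r) (rotate r ?w)" using r(3) by simp
    also have "\<dots> = ?w" using L r(2) by (simp add: rotate_rotate)
    finally have r': "rotate (?L - r) ?w = ?w" .
    show "us \<in> (\<Union>r\<in>{1..n * N}. P r)"
    proof (cases "r \<le> n * N")
      case True
      then show ?thesis using us r by (auto simp: P_def intro!: bexI[of _ r])
    next
      case False
      then show ?thesis using us r r' by (auto simp: P_def intro!: bexI[of _ "?L - r"])
    qed
  qed
  then have "card {us \<in> block_lists B (2 * n). \<not> primitive (concat us)} \<le> card (\<Union>r\<in>{1..n * N}. P r)"
    using fin by (intro card_mono) auto
  also have "\<dots> \<le> (\<Sum>r\<in>{1..n * N}. card (P r))" by (rule card_UN_le) simp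
  also have "\<dots> \<le> (\<Sum>r\<in>{1..n * N}. card B ^ n)"
    using card_P by (intro sum_mono) auto
  finally show ?thesis by simp
qed

lemma card_primitive_le:
  assumes B: "finite B" "\<And>b. b \<in> B \<Longrightarrow> length b = N" "0 < N"
    and A: "\<And>\<rho> b. \<rho> < N \<Longrightarrow> b \<in> B \<Longrightarrow> card (lyndon_block_words B k \<rho> b) \<le> A"
  shows "card {us \<in> block_lists B (Suc k). primitive (concat us)} \<le> (Suc k * N + 1) * (N * (card B * A))"
proof -
  let ?P = "{us \<in> block_lists B (Suc k). primitive (concat us)}"
  let ?U = "\<Union>r\<in>{..Suc k * N}. \<Union>\<rho>\<in>{..<N}. \<Union>b\<in>B. rotate r ` lyndon_block_words B k \<rho> b"
  have fin: "finite (lyndon_block_words B k \<rho> b)" for \<rho> b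
    by (rule finite_lyndon_block_words[OF B(1)])
  have "inj_on concat ?P"
    by (rule inj_on_subset[OF inj_on_concat_block_lists[OF B(2)]]) auto
  then have "card ?P = card (concat ` ?P)" by (simp add: card_image)
  also have "\<dots> \<le> card ?U"
  proof (rule card_mono)
    show "finite ?U" using fin B(1) by auto
    show "concat ` ?P \<subseteq> ?U"
      by (intro image_subsetI primitive_is_rotated_lyndon_block_word[OF _ B(2,3)]) simp_all
  qed
  also have "\<dots> \<le> (\<Sum>r\<in>{..Suc k * N}. \<Sum>\<rho>\<in>{..<N}. \<Sum>b\<in>B. card (rotate r ` lyndon_block_words B k \<rho> b))"
    by (intro order_trans[OF card_UN_le] sum_mono B(1)) simp_all
  also have "\<dots> \<le> (\<Sum>r\<in>{..Suc k * N}. \<Sum>\<rho>\<in>{..<N}. \<Sum>b\<in>B. A)"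
    using A by (intro sum_mono order_trans[OF card_image_le[OF fin]]) auto
  finally show ?thesis by simp
qed

text \<open>
  Up to a linear factor, the nonprimitive words number only the square root of all words over \<open>B\<close>,
  and distributing the primitive ones over the rotations and the pairs \<open>(\<rho>, b)\<close> divides their number
  by a factor linear in the length. As \<open>\<theta>\<close> is strictly smaller than the cardinality of \<open>B\<close>, long
  words make up for both losses.
\<close>
lemma ex_many_lyndon_block_words:
  fixes B :: "'a::linorder list set"
  assumes B: "finite B" "\<And>b. b \<in> B \<Longrightarrow> length b = N" "0 < N"
    and \<theta>: "1 \<le> \<theta>" "\<theta> < real (card B)"
  shows "\<exists>k \<rho> b. \<rho> < N \<and> b \<in> B \<and> \<theta> ^ Suc k + 2 \<le> real (card (lyndon_block_words B k \<rho> b))"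
proof (rule ccontr)
  assume contra: "\<not> ?thesis"
  define a where "a = real (card B)"
  define q where "q = \<theta> / a"
  have a: "1 < a" "\<theta> < a" using \<theta> by (simp_all add: a_def)
  have q: "0 < q" "q < 1" "1 / a \<le> q" using \<theta> a by (simp_all add: q_def divide_right_mono)
  define C where "C = real N + 9 * real N ^ 2 * a"
  have "(\<lambda>n. real n * q ^ n) \<longlonglongrightarrow> 0"
    using q by (intro powser_times_n_limit_0) simp
  then have "(\<lambda>n. C * (real n * q ^ n)) \<longlonglongrightarrow> 0"
    by (intro tendsto_mult_right_zero)
  then have "\<forall>\<^sub>F n in sequentially. C * (real n * q ^ n) < 1"
    by (rule order_tendstoD) simp
  then obtain n where n: "n > 0" "C * (real n * q ^ n) < 1"
    using eventually_happens'[OF sequentially_bot eventually_conj[OF eventually_gt_at_top[of 0]]]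
    by blast
  (* An even number of blocks, so that half of them can be taken in the count of nonprimitive words. *)
  obtain k where k: "2 * n = Suc k" using n(1) by (cases "2 * n") auto
  define A where "A = nat \<lfloor>3 * \<theta> ^ (2 * n)\<rfloor>"
  have "1 \<le> \<theta> ^ (2 * n)" using \<theta>(1) by simp
  have few: "card (lyndon_block_words B k \<rho> b) \<le> A" if "\<rho> < N" "b \<in> B" for \<rho> b
  proof -
    have "real (card (lyndon_block_words B k \<rho> b)) < \<theta> ^ Suc k + 2"
      using contra that by (meson not_le)
    also have "\<dots> \<le> 3 * \<theta> ^ (2 * n)" using \<open>1 \<le> \<theta> ^ (2 * n)\<close> k by simp
    finally show ?thesis unfolding A_def by linarith
  qed
  have A_le: "real A \<le> 3 * \<theta> ^ (2 * n)"
    using \<open>1 \<le> \<theta> ^ (2 * n)\<close> by (simp add: A_def)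
  let ?X = "block_lists B (2 * n)"
  have "card ?X \<le> card {us \<in> ?X. \<not> primitive (concat us)} + card {us \<in> ?X. primitive (concat us)}"
    by (rule order_trans[OF card_mono card_Un_le]) (auto simp: finite_block_lists B(1))
  also have "\<dots> \<le> n * N * card B ^ n + (2 * n * N + 1) * (N * (card B * A))"
    using card_nonprimitive_le[OF B(1,2), of n] card_primitive_le[OF B few] unfolding k by simp
  finally have "real (card B ^ (2 * n)) \<le> real (n * N * card B ^ n + (2 * n * N + 1) * (N * (card B * A)))"
    unfolding card_block_lists[OF B(1)] of_nat_le_iff .
  then have "a ^ (2 * n) \<le> real n * real N * a ^ n + (2 * real n * real N + 1) * (real N * (a * real A))"
    by (simp add: a_def algebra_simps)
  also have "\<dots> \<le> real n * real N * a ^ n + (3 * real n * real N) * (real N * (a * (3 * \<theta> ^ (2 * n))))"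
  proof (intro add_left_mono mult_mono A_le)
    have "1 \<le> n * N" using n(1) B(3) by simp
    then have "real 1 \<le> real (n * N)" unfolding of_nat_le_iff .
    then have "1 \<le> real n * real N" by simp
    then show "2 * real n * real N + 1 \<le> 3 * real n * real N" by linarith
  qed (use a in auto)
  also have "\<dots> \<le> a ^ (2 * n) * (C * (real n * q ^ n))"
  proof -
    have "a ^ (2 * n) = a ^ n * a ^ n" unfolding mult_2 power_add ..
    then have "a ^ n = a ^ (2 * n) * (1 / a) ^ n" using a(1) by (simp add: power_one_over)
    also have "\<dots> \<le> a ^ (2 * n) * q ^ n" using a q by (intro mult_left_mono power_mono) auto
    finally have 1: "a ^ n \<le> a ^ (2 * n) * q ^ n" .
    have "\<theta> ^ (2 * n) = a ^ (2 * n) * q ^ (2 * n)" using a by (simp add: q_def power_divide)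
    also have "\<dots> \<le> a ^ (2 * n) * q ^ n"
      using a q by (intro mult_left_mono power_decreasing) auto
    finally have 2: "\<theta> ^ (2 * n) \<le> a ^ (2 * n) * q ^ n" .
    have "real n * real N * a ^ n + (3 * real n * real N) * (real N * (a * (3 * \<theta> ^ (2 * n))))
      \<le> real n * real N * (a ^ (2 * n) * q ^ n) + (3 * real n * real N) * (real N * (a * (3 * (a ^ (2 * n) * q ^ n))))"
      using 1 2 a by (intro add_mono mult_left_mono) auto
    also have "\<dots> = a ^ (2 * n) * (C * (real n * q ^ n))"
      by (simp add: C_def algebra_simps power2_eq_square)
    finally show ?thesis .
  qed
  also have "\<dots> < a ^ (2 * n) * 1"
    using n(2) a by (intro mult_strict_left_mono) auto
  finally show False by simp
qed

section \<open>The size of the smaller set\<close>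

lemma blocks_at_block:
  assumes "r < L"
  shows "blocks L ls (q * L + r) = ls q ! r"
  using assms by (simp add: blocks_def)

text \<open>
  The sequence lies in \<open>M'_set\<close> because it is a shift of a concatenation of blocks of \<open>B\<close>. It is greater
  than its proper shifts: one that starts inside a block begins with a proper suffix of a Lyndon word,
  which loses against a prefix of that word and hence against the first block, and one that starts at
  a block begins with a word smaller than the first block.
\<close>
lemma lyndon_concatenation_in_M_set:
  assumes free: "\<And>bs. (\<And>q. bs q \<in> B) \<Longrightarrow> blocks N bs \<in> M'_set m c d"
    and B: "\<And>b. b \<in> B \<Longrightarrow> length b = N" "\<rho> < N" "b \<in> B"
    and ls: "\<And>q. ls q \<in> lyndon_block_words B k \<rho> b" "\<And>q. ls (Suc q) < ls 0"
  shows "blocks (N * Suc k) ls \<in> M_set m c d"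
proof -
  define L where "L = N * Suc k"
  let ?x = "blocks L ls"
  have len: "length (ls q) = L" for q
    unfolding L_def by (rule length_lyndon_block_words[OF ls(1) B(3,1,2)])
  have "0 < L" "0 < N" using B(2) by (simp_all add: L_def)
  have "\<exists>us. us \<in> block_lists B k \<and> ls q = drop \<rho> b @ concat us @ take \<rho> b" for q
    using ls(1)[of q] by (auto simp: lyndon_block_words_def)
  then obtain us where us: "\<And>q. us q \<in> block_lists B k"
      "\<And>q. ls q = drop \<rho> b @ concat (us q) @ take \<rho> b"
    by metis
  define bs where "bs = (\<lambda>n. (b # us (n div Suc k)) ! (n mod Suc k))"
  have cons: "b # us q \<in> block_lists B (Suc k)" for q
    using us(1)[of q] B(3) by (simp add: block_lists_def)
  have "bs n \<in> B" for n
  proof -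
    have "(b # us (n div Suc k)) ! (n mod Suc k) \<in> set (b # us (n div Suc k))"
      using cons[of "n div Suc k"] by (intro nth_mem) (simp add: block_lists_def)
    then show ?thesis using cons[of "n div Suc k"] unfolding bs_def block_lists_def by blast
  qed
  then have "(\<lambda>p. blocks N bs (\<rho> + p)) \<in> M'_set m c d"
    by (intro M'_set_shift free)
  also have "(\<lambda>p. blocks N bs (\<rho> + p)) = ?x"
  proof
    fix p
    have "blocks N bs = blocks L (\<lambda>q. concat (b # us q))"
      unfolding bs_def L_def using cons B(1) \<open>0 < N\<close> by (intro blocks_concat) simp_all
    then have "blocks N bs (\<rho> + p) = blocks L (\<lambda>q. b @ concat (us q)) (\<rho> + p)" by simp
    also have "\<dots> = ?x p"
      unfolding us(2) using len B by (intro blocks_rotate_common_prefix) (auto simp: us(2))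
    finally show "blocks N bs (\<rho> + p) = ?x p" .
  qed
  finally have "?x \<in> M'_set m c d" .
  moreover have "less_fun (\<lambda>p. ?x (n + p)) ?x" if "1 \<le> n" for n
  proof (rule less_fun_if_take_seq_less)
    let ?q = "n div L" and ?r = "n mod L"
    have r: "?r < L" using \<open>0 < L\<close> by simp
    have n: "n + p = ?q * L + (?r + p)" for p by simp
    have "take_seq (L - ?r) (\<lambda>p. ?x (n + p)) = drop ?r (ls ?q)"
    proof (rule nth_equalityI)
      fix p assume "p < length (take_seq (L - ?r) (\<lambda>p. ?x (n + p)))"
      then have p: "p < L - ?r" by simp
      then have "?x (n + p) = ls ?q ! (?r + p)"
        unfolding n by (intro blocks_at_block) simp
      then show "take_seq (L - ?r) (\<lambda>p. ?x (n + p)) ! p = drop ?r (ls ?q) ! p"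
        using p len[of ?q] r by (simp only: nth_take_seq nth_drop less_imp_le)
    qed (use len[of ?q] in simp)
    moreover have "take_seq (L - ?r) ?x = take (L - ?r) (ls 0)"
      using len[of 0] r blocks_at_block[of _ L ls 0, simplified] by (intro nth_equalityI) simp_all
    moreover have "drop ?r (ls ?q) < take (L - ?r) (ls 0)"
    proof (cases "?r = 0")
      case True
      then have "?q \<noteq> 0" using that by (metis One_nat_def div_mult_mod_eq add_0_right mult_0 not_one_le_zero)
      then obtain q where "?q = Suc q" by (cases ?q) auto
      then show ?thesis using True ls(2) len[of 0] by simp
    next
      case False
      have "ls ?q \<le> ls 0" using ls(2) by (cases ?q) (auto intro: less_imp_le)
      then have "take (L - ?r) (ls ?q) \<le> take (L - ?r) (ls 0)"
        using len by (intro take_mono_if_length_eq) simp_all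
      moreover have "drop ?r (ls ?q) < take (L - ?r) (ls ?q)"
        using ls(1)[of ?q] False r len[of ?q] by (auto simp: lyndon_block_words_def lyndon_def)
      ultimately show ?thesis by (rule order_less_le_trans[rotated])
    qed
    ultimately show "take_seq (L - ?r) (\<lambda>p. ?x (n + p)) < take_seq (L - ?r) ?x" by simp
  qed
  ultimately show ?thesis unfolding mem_M_set_iff L_def by blast
qed

text \<open>
  The greatest of many Lyndon block words of equal length is put in front, and the others follow in
  any order.
\<close>
lemma M_set_not_null_if_free_blocks:
  assumes "0 \<le> t" "0 < N" "finite B" and B: "\<And>b. b \<in> B \<Longrightarrow> set b \<subseteq> {0..m} \<and> length b = N"
    and free: "\<And>bs. (\<And>q. bs q \<in> B) \<Longrightarrow> blocks N bs \<in> M'_set m c d"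
    and many: "(real (m + 1) ^ N) powr t < real (card B)"
  shows "seq_hausdorff_measure m t (M_set m c d) \<noteq> 0"
proof -
  define \<theta> where "\<theta> = (real (m + 1) ^ N) powr t"
  have "1 \<le> \<theta>" unfolding \<theta>_def using assms(1) by (intro ge_one_powr_ge_zero) auto
  obtain k \<rho> b where k: "\<rho> < N" "b \<in> B"
      "\<theta> ^ Suc k + 2 \<le> real (card (lyndon_block_words B k \<rho> b))"
    using ex_many_lyndon_block_words[OF assms(3) _ assms(2) \<open>1 \<le> \<theta>\<close>] many B unfolding \<theta>_def by metis
  define E where "E = lyndon_block_words B k \<rho> b"
  (* Giving up v costs one word, and base expansions need at least two, hence the summand 2 in k(3). *)
  define v where "v = Max E"
  have "finite E" unfolding E_def by (rule finite_lyndon_block_words[OF assms(3)])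
  have "1 \<le> \<theta> ^ Suc k" using \<open>1 \<le> \<theta>\<close> by (rule one_le_power)
  then have "2 < card E" using k(3) by (simp add: E_def)
  then have "v \<in> E" unfolding v_def using \<open>finite E\<close> by (intro Max_in) auto
  then have card: "card (E - {v}) = card E - 1" using \<open>finite E\<close> by simp
  have E_words: "set w \<subseteq> {0..m} \<and> length w = N * Suc k" if "w \<in> E" for w
  proof
    show "length w = N * Suc k"
      using B by (intro length_lyndon_block_words[OF that[unfolded E_def] k(2) _ k(1)]) simp
    obtain us where us: "set us \<subseteq> B" "w = drop \<rho> b @ concat us @ take \<rho> b"
      using \<open>w \<in> E\<close> by (auto simp: E_def lyndon_block_words_def block_lists_def)
    then have "set w \<subseteq> (\<Union>b\<in>B. set b)"
      using k(2) by (auto dest: in_set_dropD in_set_takeD)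
    then show "set w \<subseteq> {0..m}" using B by blast
  qed
  show ?thesis
  proof (rule hausdorff_measure_blocks_pos[where E = "E - {v}" and v = v and L = "N * Suc k"])
    show "0 < N * Suc k" "0 \<le> t" "finite (E - {v})" using assms \<open>finite E\<close> by simp_all
    show "2 \<le> card (E - {v})" using card \<open>2 < card E\<close> by simp
    have "(real (m + 1) ^ (N * Suc k)) powr t = \<theta> ^ Suc k"
      unfolding \<theta>_def power_mult
      by (rule power_powr_swap) simp
    also have "\<dots> \<le> real (card (E - {v}))"
      using k(3) card \<open>2 < card E\<close> by (simp add: E_def)
    finally show "(real (m + 1) ^ (N * Suc k)) powr t \<le> real (card (E - {v}))" .
    show "set w \<subseteq> {0..m} \<and> length w = N * Suc k" if "w \<in> insert v (E - {v})" for w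
      using that \<open>v \<in> E\<close> E_words by auto
    fix ls assume ls: "ls 0 = v" "\<And>q. ls (Suc q) \<in> E - {v}"
    show "blocks (N * Suc k) ls \<in> M_set m c d"
    proof (rule lyndon_concatenation_in_M_set[OF free _ k(1,2)])
      show "length b = N" if "b \<in> B" for b using that B by blast
      show "ls q \<in> lyndon_block_words B k \<rho> b" for q
        using ls \<open>v \<in> E\<close> unfolding E_def by (cases q) auto
      show "ls (Suc q) < ls 0" for q
        using ls Max_ge[OF \<open>finite E\<close>, of "ls (Suc q)"] by (auto simp: v_def order.strict_iff_order)
    qed
  qed
qed

lemma M'_set_null_above_M_set_null:
  assumes "1 \<le> m" "self_admissible m c d" "0 \<le> t" "t < s"
    and null: "seq_hausdorff_measure m t (M_set m c d) = 0"
  shows "seq_hausdorff_measure m s (M'_set m c d) = 0"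
proof (rule M'_set_null_if_few_loops[OF assms(1,3,4)], rule ccontr)
  fix i j N assume N: "0 < N"
    and "\<not> real (card (loops m c d i j N)) \<le> (real (m + 1) ^ N) powr t"
  then have "seq_hausdorff_measure m t (M_set m c d) \<noteq> 0"
    using loops_free[OF assms(2) N] loops_words
    by (intro M_set_not_null_if_free_blocks[OF assms(3) N finite_loops]) (auto simp: not_le)
  then show False using null by simp
qed

theorem proposition5:
  fixes m :: nat and c d :: "nat \<Rightarrow> nat"
  assumes "1 \<le> m"
    and "c \<in> digit_seqs m" and "d \<in> digit_seqs m"
    and "less_fun c d"
  shows "Metric_space.hausdorff_dim (digit_seqs m) (seq_dist m) (M_set m c d)
       = Metric_space.hausdorff_dim (digit_seqs m) (seq_dist m) (M'_set m c d)"
proof (cases "M'_set m c d = {}")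
  case True
  then have "M_set m c d = M'_set m c d" using M_set_subset_M'_set by blast
  then show ?thesis by simp
next
  case False
  interpret Metric_space "digit_seqs m" "seq_dist m" by (rule Metric_space_seq_dist)
  obtain c' d' where adm: "self_admissible m c' d'" "lex_le c c'" "lex_le d' d"
      "M'_set m c' d' = M'_set m c d"
    using ex_self_admissible_bounds[OF False] by blast
  show ?thesis
  proof (rule order.antisym)
    show "hausdorff_dim (M_set m c d) \<le> hausdorff_dim (M'_set m c d)"
      by (rule hausdorff_dim_mono[OF M_set_subset_M'_set])
    have "hausdorff_dim (M'_set m c d) \<le> hausdorff_dim (M_set m c' d')"
      unfolding adm(4)[symmetric]
      by (rule hausdorff_dim_le_if_null_above) (rule M'_set_null_above_M_set_null[OF assms(1) adm(1)])
    also have "\<dots> \<le> hausdorff_dim (M_set m c d)"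
      by (rule hausdorff_dim_mono[OF M_set_mono[OF adm(2,3)]])
    finally show "hausdorff_dim (M'_set m c d) \<le> hausdorff_dim (M_set m c d)" .
  qed
qed

end
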